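(* Let $d \ge 3$, let $\mathcal{G}(n)$ be a symmetric, (strongly) connected directed graph on $n$ nodes, and let $A=[a_{ij}]\in\mathbb{R}^{n\times n}$ be a symmetric weight matrix for $\mathcal{G}(n)$ such that $$a_{ii} > \sqrt{2}\sum_{j\neq i} a_{ij}\quad \text{for all } i .$$ Then the subset $$\{x \in (\mathbb{S}^{d-1})^n : \exists\, x_\infty \in \mathcal{F}\setminus\mathcal{C} \text{ such that } \lim_{k\to+\infty} f^k(x) = x_\infty\}$$ of $(\mathbb{S}^{d-1})^n$ has measure zero.
   Context: A directed graph $\mathcal{G}(n)=(\mathcal{V}(n),\mathcal{E})$ has nodes $\mathcal{V}(n)=\{1,\dots,n\}$ and edges $\mathcal{E}\subset \mathcal{V}(n)\times\mathcal{V}(n)$. It is strongly connected if there is a directed path between any two nodes; it is symmetric if $(i,j)\in\mathcal{E}$ implies $(j,i)\in\mathcal{E}$. A matrix $A=[a_{ij}]\in\mathbb{R}^{n\times n}$ is a weight matrix for $\mathcal{G}(n)$ if all its entries are non-negative and, for all $i\neq j$, $a_{ij}>0$ if and only if $(i,j)\in\mathcal{E}$. It is strictly diagonally dominant if $a_{ii}>\sum_{j\ne i}a_{ij}$ for all $i$ (this is implied by the hypothesis of the claim). $\mathbb{S}^{d-1}$ is the Euclidean unit sphere in $\mathbb{R}^d$, and $(\mathbb{S}^{d-1})^n$ is the set of stacked vectors $x=[x_1^T,\dots,x_n^T]^T\in\mathbb{R}^{nd}$ with each $x_i\in\mathbb{S}^{d-1}$. Measure zero is with respect to the standard (Riemannian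 volume, i.e. product surface) measure on $(\mathbb{S}^{d-1})^n$. For a strictly diagonally dominant weight matrix $A$, the map $f:(\mathbb{S}^{d-1})^n\to(\mathbb{S}^{d-1})^n$ is defined by $f(x)=[f_1(x)^T,\dots,f_n(x)^T]^T$ with $$f_i(x)=\frac{\sum_{j=1}^n a_{ij}x_j}{\left\|\sum_{j=1}^n a_{ij}x_j\right\|_2},$$ which is well defined (no division by zero); $f^k$ is its $k$-fold iterate. The set of fixed points is $\mathcal{F}=\{x\in(\mathbb{S}^{d-1})^n: f(x)=x\}$ and the consensus set is $\mathcal{C}=\{x\in(\mathbb{S}^{d-1})^n: x_1=x_2=\dots=x_n\}$; one has $\mathcal{C}\subset\mathcal{F}$. *)

theory Defs
  imports "HOL-Analysis.Analysis"
begin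

text \<open>
  The node set \<open>{1, ..., n}\<close> is the universe of a finite type \<open>'n\<close>, the ambient space of
  each state is \<open>real ^ 'd\<close>, and a stacked vector in dimension \<open>n d\<close> is a value of type
  \<open>real ^ 'd ^ 'n\<close>. Edge sets may contain loops.
\<close>

definition strongly_connected :: "('n \<times> 'n) set \<Rightarrow> bool" where
  "strongly_connected E \<longleftrightarrow> (\<forall>i j. (i, j) \<in> E\<^sup>*)"

definition weight_matrix :: "('n::finite \<times> 'n) set \<Rightarrow> real ^ 'n ^ 'n \<Rightarrow> bool" where
  "weight_matrix E A \<longleftrightarrow>
     (\<forall>i j. 0 \<le> A $ i $ j) \<and> (\<forall>i j. i \<noteq> j \<longrightarrow> (0 < A $ i $ j \<longleftrightarrow> (i, j) \<in> E))"

definition sphere_product :: "(real ^ 'd ^ 'n) set" where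
  "sphere_product = {x. \<forall>i. x $ i \<in> sphere 0 1}"

definition consensus_map :: "real ^ 'n ^ 'n \<Rightarrow> real ^ 'd ^ 'n \<Rightarrow> real ^ 'd ^ 'n" where
  "consensus_map A x =
     (\<chi> i. (\<Sum>j\<in>UNIV. A $ i $ j *\<^sub>R x $ j) /\<^sub>R norm (\<Sum>j\<in>UNIV. A $ i $ j *\<^sub>R x $ j))"

definition fixed_points :: "real ^ 'n ^ 'n \<Rightarrow> (real ^ 'd ^ 'n) set" where
  "fixed_points A = {x \<in> sphere_product. consensus_map A x = x}"

definition consensus_set :: "(real ^ 'd ^ 'n) set" where
  "consensus_set = {x \<in> sphere_product. \<forall>i j. x $ i = x $ j}"

text \<open>
  The surface measure of the unit sphere is given by the cone formula
  \<open>\<sigma> B = d * \<lambda> {t u | 0 < t < 1, u \<in> B}\<close>, that is, \<open>d\<close> times the image of Lebesgue measure on the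
  punctured unit ball under radial projection.
\<close>

definition sphere_measure :: "'a::euclidean_space measure" where
  "sphere_measure =
     scale_measure (of_nat DIM('a))
       (distr (restrict_space lborel (ball 0 1 - {0})) (restrict_space borel (sphere 0 1)) sgn)"

definition sphere_product_measure :: "(real ^ 'd ^ 'n) measure" where
  "sphere_product_measure =
     distr (PiM UNIV (\<lambda>_. sphere_measure)) (restrict_space borel sphere_product) vec_lambda"

lemma space_sphere_measure [simp]: "space (sphere_measure :: 'a::euclidean_space measure) = sphere 0 1"
  by (simp add: sphere_measure_def space_scale_measure space_restrict_space)

lemma sets_sphere_measure [measurable_cong]:
  "sets (sphere_measure :: 'a::euclidean_space measure) = sets (restrict_space borel (sphere 0 1))"
  by (simp add: sphere_measure_def)

lemma sgn_measurable_sphere: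
  "sgn \<in> restrict_space lborel (ball 0 1 - {0 :: 'a::euclidean_space})
           \<rightarrow>\<^sub>M restrict_space borel (sphere 0 1)"
proof (rule measurable_restrict_space2)
  show "sgn \<in> space (restrict_space lborel (ball 0 1 - {0 :: 'a})) \<rightarrow> sphere 0 1"
    by (auto simp: space_restrict_space norm_sgn)
  have "sgn \<in> borel_measurable (lborel :: 'a measure)"
    by simp
  then show "sgn \<in> borel_measurable (restrict_space lborel (ball 0 1 - {0 :: 'a}))"
    by (rule measurable_restrict_space1)
qed

lemma emeasure_sphere_measure:
  fixes B :: "'a::euclidean_space set"
  assumes "B \<in> sets borel" "B \<subseteq> sphere 0 1"
  shows "emeasure sphere_measure B =
    of_nat DIM('a) * emeasure lborel {t *\<^sub>R u | t u. 0 < t \<and> t < 1 \<and> u \<in> B}"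
proof -
  have B: "B \<in> sets (restrict_space borel (sphere 0 1))"
    using assms by (auto simp: sets_restrict_space_iff)
  have eq: "sgn -` B \<inter> space (restrict_space lborel (ball 0 1 - {0 :: 'a}))
      = {t *\<^sub>R u | t u. 0 < t \<and> t < 1 \<and> u \<in> B}" (is "?L = ?R")
  proof
    show "?L \<subseteq> ?R"
    proof
      fix x assume x: "x \<in> ?L"
      then have "x = norm x *\<^sub>R sgn x" "0 < norm x" "norm x < 1" "sgn x \<in> B"
        by (auto simp: space_restrict_space sgn_div_norm)
      then show "x \<in> ?R" by blast
    qed
    show "?R \<subseteq> ?L"
    proof
      fix x assume "x \<in> ?R"
      then obtain t u where "x = t *\<^sub>R u" "0 < t" "t < 1" "u \<in> B" by blast
      moreover from this have "norm u = 1" using assms(2) by auto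
      ultimately show "x \<in> ?L" by (auto simp: space_restrict_space sgn_div_norm)
    qed
  qed
  show ?thesis
    by (simp add: sphere_measure_def emeasure_distr[OF sgn_measurable_sphere B] eq[symmetric])
      (subst emeasure_restrict_space, auto simp: space_restrict_space)
qed

lemma vec_lambda_measurable_sphere_product:
  "vec_lambda \<in> PiM UNIV (\<lambda>_::'n::finite. sphere_measure :: (real ^ 'd) measure)
                  \<rightarrow>\<^sub>M restrict_space borel sphere_product"
proof (rule measurable_restrict_space2)
  let ?M = "PiM UNIV (\<lambda>_::'n. sphere_measure :: (real ^ 'd) measure)"
  show "vec_lambda \<in> space ?M \<rightarrow> sphere_product"
    by (auto simp: space_PiM sphere_product_def PiE_def Pi_def)
  have comp: "(\<lambda>g. g i) \<in> borel_measurable ?M" for i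
  proof -
    have "(\<lambda>g. g i) \<in> ?M \<rightarrow>\<^sub>M (sphere_measure :: (real ^ 'd) measure)"
      by (rule measurable_component_singleton) simp
    then have "(\<lambda>g. g i) \<in> ?M \<rightarrow>\<^sub>M restrict_space borel (sphere 0 1)"
      using measurable_cong_sets[OF refl sets_sphere_measure] by blast
    then show ?thesis by (simp add: measurable_restrict_space2_iff)
  qed
  show "vec_lambda \<in> borel_measurable ?M"
  proof (rule borel_measurable_euclidean_space[THEN iffD2], rule ballI)
    fix b :: "real ^ 'd ^ 'n" assume "b \<in> Basis"
    then obtain i and u :: "real ^ 'd" where b: "b = axis i u"
      by (auto simp: Basis_vec_def)
    have "(\<lambda>g. g i \<bullet> u) \<in> borel_measurable ?M"
      using comp by (intro borel_measurable_inner) auto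
    then show "(\<lambda>g. vec_lambda g \<bullet> b) \<in> borel_measurable ?M"
      by (simp add: b inner_axis)
  qed
qed

lemma finite_measure_sphere_measure:
  "finite_measure (sphere_measure :: 'a::euclidean_space measure)"
proof (rule finite_measureI)
  have "{t *\<^sub>R u | t u. 0 < t \<and> t < 1 \<and> u \<in> sphere 0 1} \<subseteq> ball (0 :: 'a) 1"
    by auto
  then have "emeasure lborel {t *\<^sub>R u | t u. 0 < t \<and> t < 1 \<and> u \<in> sphere (0 :: 'a) 1}
      \<le> emeasure lborel (ball (0 :: 'a) 1)"
    by (intro emeasure_mono) auto
  also have "\<dots> < \<infinity>"
    by (rule emeasure_lborel_ball_finite)
  finally have "emeasure (sphere_measure :: 'a measure) (sphere 0 1) < \<infinity>"
    by (subst emeasure_sphere_measure) (auto simp: ennreal_mult_less_top ennreal_of_nat_eq_real_of_nat)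
  then show "emeasure sphere_measure (space (sphere_measure :: 'a measure)) \<noteq> \<infinity>"
    by simp
qed

lemma emeasure_sphere_product_measure_box:
  fixes B :: "'n::finite \<Rightarrow> (real ^ 'd) set"
  assumes "\<And>i. B i \<in> sets borel" "\<And>i. B i \<subseteq> sphere 0 1"
  shows "emeasure sphere_product_measure {x. \<forall>i. x $ i \<in> B i}
    = (\<Prod>i\<in>UNIV. emeasure sphere_measure (B i))"
proof -
  interpret finite_product_sigma_finite "\<lambda>_::'n. sphere_measure :: (real ^ 'd) measure" UNIV
    using finite_measure_sphere_measure
    by (auto simp: finite_product_sigma_finite_def product_sigma_finite_def finite_measure_def
        finite_product_sigma_finite_axioms_def)
  have B: "B i \<in> sets sphere_measure" for i
    using assms by (auto simp: sets_sphere_measure sets_restrict_space_iff)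
  have "(\<lambda>x. x $ i) -` B i \<in> sets borel" for i
    using measurable_sets[of "\<lambda>x. x $ i" borel borel "B i"] assms(1)
    by (simp add: borel_measurable_continuous_onI continuous_on_component)
  then have "(\<Inter>i. (\<lambda>x. x $ i) -` B i) \<in> sets borel"
    by (intro sets.finite_INT) auto
  then have "(\<Inter>i. (\<lambda>x. x $ i) -` B i) \<inter> sphere_product \<in> sets (restrict_space borel sphere_product)"
    by (auto simp: sets_restrict_space)
  moreover have "(\<Inter>i. (\<lambda>x. x $ i) -` B i) \<inter> sphere_product = {x. \<forall>i. x $ i \<in> B i}"
    using assms(2) by (auto simp: sphere_product_def subset_iff)
  ultimately have "{x. \<forall>i. x $ i \<in> B i} \<in> sets (restrict_space borel sphere_product)"
    by simp
  moreover have "vec_lambda -` {x. \<forall>i. x $ i \<in> B i}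
      \<inter> space (PiM UNIV (\<lambda>_::'n. sphere_measure :: (real ^ 'd) measure)) = PiE UNIV B"
    using assms(2) by (auto simp: space_PiM PiE_def Pi_def subset_iff)
  ultimately have "emeasure sphere_product_measure {x. \<forall>i. x $ i \<in> B i}
      = emeasure (PiM UNIV (\<lambda>_. sphere_measure)) (PiE UNIV B)"
    by (simp add: sphere_product_measure_def emeasure_distr[OF vec_lambda_measurable_sphere_product])
  also have "\<dots> = (\<Prod>i\<in>UNIV. emeasure sphere_measure (B i))"
    using B by (intro measure_times) auto
  finally show ?thesis .
qed

end

theory Submission
  imports Defs
begin

text \<open>
  Let \<open>x\<close> be a fixed point outside the consensus set. The derivative of \<open>f\<close> at \<open>x\<close> is a positive
  semidefinite operator \<open>L\<close>, self-adjoint for the inner product \<open>G u v = \<Sum>\<^sub>i \<lambda>\<^sub>i (u\<^sub>i \<bullet> v\<^sub>i)\<close> with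
  \<open>\<lambda>\<^sub>i = norm (\<Sum>\<^sub>j a\<^sub>i\<^sub>j x\<^sub>j)\<close>, and for \<open>d \<ge> 3\<close> it has an eigenvalue above 1. No stable manifold theorem is
  needed: for a suitable \<open>\<theta> > 1\<close> the form \<open>Q v = G (L v) v - \<theta> G v v\<close> grows by \<open>\<theta>\<^sup>2\<close> along differences of
  orbits staying near \<open>x\<close>, so two such orbits never start with a difference on which \<open>Q\<close> is positive.
  Hence the closed set of points trapped near \<open>x\<close>, extended to a cone, meets each ray in an unstable
  direction at most once and is negligible. The hypothesis with \<open>sqrt 2\<close> makes \<open>f\<close> injective with a
  Lipschitz inverse, so preimages of null sets are null, and countably many preimages of trapped sets
  cover the set in question.
\<close>

subsection \<open>Preimages under normalization on the sphere\<close>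

text \<open>The condition \<open>2 * r\<^sup>2 \<le> a\<^sup>2\<close> keeps the circle of radius
  \<open>a\<close> where its slope is at most 1, that is
  \<open>t \<le> sqrt (a\<^sup>2 - t\<^sup>2)\<close> on [0, r]. Factoring both differences of
  squares then compares the increments.\<close>

lemma sqrt_diff_squares_Lipschitz:
  fixes a p q r :: real
  assumes "0 < a" "0 \<le> p" "p \<le> r" "0 \<le> q" "q \<le> r" "2 * r\<^sup>2 \<le> a\<^sup>2"
  shows "\<bar>sqrt (a\<^sup>2 - p\<^sup>2) - sqrt (a\<^sup>2 - q\<^sup>2)\<bar> \<le> \<bar>p - q\<bar>"
proof -
  have ge: "t \<le> sqrt (a\<^sup>2 - t\<^sup>2)" "0 < sqrt (a\<^sup>2 - t\<^sup>2)" "(sqrt (a\<^sup>2 - t\<^sup>2))\<^sup>2 = a\<^sup>2 - t\<^sup>2"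
    if "0 \<le> t" "t \<le> r" for t
  proof -
    have "t\<^sup>2 \<le> r\<^sup>2" using that by (simp add: power_mono)
    then have le: "t\<^sup>2 \<le> a\<^sup>2 - t\<^sup>2" and pos: "0 < a\<^sup>2 - t\<^sup>2"
      using assms(6) zero_less_power[OF assms(1), of 2] zero_le_power2[of t] by linarith+
    show "t \<le> sqrt (a\<^sup>2 - t\<^sup>2)" using le by (rule real_le_rsqrt)
    show "0 < sqrt (a\<^sup>2 - t\<^sup>2)" "(sqrt (a\<^sup>2 - t\<^sup>2))\<^sup>2 = a\<^sup>2 - t\<^sup>2" using pos by simp_all
  qed
  define h k where "h = sqrt (a\<^sup>2 - p\<^sup>2)" and "k = sqrt (a\<^sup>2 - q\<^sup>2)"
  have hk: "p \<le> h" "q \<le> k" "0 < h" "0 < k" "h\<^sup>2 = a\<^sup>2 - p\<^sup>2" "k\<^sup>2 = a\<^sup>2 - q\<^sup>2"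
    using ge[OF assms(2,3)] ge[OF assms(4,5)] unfolding h_def k_def by auto
  have "(h - k) * (h + k) = (q - p) * (q + p)"
    using hk(5,6) by (simp add: algebra_simps power2_eq_square)
  then have "\<bar>h - k\<bar> * (h + k) = \<bar>q - p\<bar> * (q + p)"
    using hk(3,4) assms(2,4) by (metis abs_mult abs_of_nonneg add_nonneg_nonneg less_imp_le)
  also have "\<dots> \<le> \<bar>q - p\<bar> * (h + k)"
    using hk(1,2) by (intro mult_left_mono) auto
  finally have "\<bar>h - k\<bar> \<le> \<bar>q - p\<bar>"
    by (rule mult_right_le_imp_le) (use hk(3,4) in simp)
  then show ?thesis
    by (simp add: h_def k_def abs_minus_commute)
qed

text \<open>This solves for \<open>x\<close> in terms of \<open>y\<close> and \<open>s\<close>.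
  Subtracting \<open>s\<close> from a multiple of \<open>y\<close> leaves the orthogonal part
  \<open>- u\<close>, and the length \<open>a\<close> fixes the coefficient of \<open>y\<close> up
  to sign; \<open>norm s < a\<close> makes it nonnegative.\<close>

lemma sphere_decomposition:
  fixes x s :: "'a::real_inner"
  assumes "norm x = 1" "norm s < a"
  defines "y \<equiv> sgn (a *\<^sub>R x + s)"
  defines "u \<equiv> s - (s \<bullet> y) *\<^sub>R y"
  shows "a *\<^sub>R x = - u + sqrt (a\<^sup>2 - (norm u)\<^sup>2) *\<^sub>R y" "norm y = 1"
proof -
  define p where "p = a *\<^sub>R x + s"
  have a: "a > 0" using assms(2) norm_ge_zero[of s] by linarith
  have "norm (a *\<^sub>R x) - norm (- s) \<le> norm p"
    using norm_triangle_ineq2[of "a *\<^sub>R x" "- s"] by (simp add: p_def)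
  then have p: "norm p > 0" using assms(1,2) a by (simp del: zero_less_norm_iff)
  show ny: "norm y = 1" using p by (simp add: y_def p_def[symmetric] norm_sgn)
  have py: "p = norm p *\<^sub>R y" using p by (simp add: y_def p_def[symmetric] sgn_div_norm)
  define h where "h = norm p - s \<bullet> y"
  have ax: "a *\<^sub>R x = - u + h *\<^sub>R y"
    using py by (simp add: p_def u_def h_def algebra_simps)
  have uy: "u \<bullet> y = 0"
    using ny by (simp add: u_def inner_diff_left norm_eq_1)
  have "a\<^sup>2 = (a *\<^sub>R x) \<bullet> (a *\<^sub>R x)"
    using assms(1) by (simp add: norm_eq_1 power2_eq_square)
  also have "\<dots> = (norm u)\<^sup>2 + h\<^sup>2"
    unfolding ax power2_norm_eq_inner using uy ny
    by (simp add: inner_simps norm_eq_1 inner_commute[of y u] power2_eq_square)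
  finally have h2: "h\<^sup>2 = a\<^sup>2 - (norm u)\<^sup>2" by simp
  have "h = (a *\<^sub>R x) \<bullet> y"
    unfolding ax using uy ny by (simp add: inner_simps norm_eq_1)
  then have hx: "h = a * (x \<bullet> y)" by simp
  \<comment> \<open>The sign of \<open>h\<close> is that of \<open>x \<bullet> y\<close>, which is
    decided here.\<close>
  have "norm p * (x \<bullet> y) = x \<bullet> p" by (metis py inner_scaleR_right)
  also have "\<dots> = a + x \<bullet> s" using assms(1) by (simp add: p_def inner_simps norm_eq_1)
  also have "\<dots> > 0"
    using Cauchy_Schwarz_ineq2[of x s] assms(1,2) by simp
  finally have "x \<bullet> y > 0" using p by (simp add: zero_less_mult_iff)
  then have "h \<ge> 0" using hx a by simp
  then have "sqrt (a\<^sup>2 - (norm u)\<^sup>2) = h" using h2 by (metis real_sqrt_unique)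
  then show "a *\<^sub>R x = - u + sqrt (a\<^sup>2 - (norm u)\<^sup>2) *\<^sub>R y" using ax by simp
qed

lemma norm_orthogonal_part_le:
  fixes s y :: "'a::real_inner"
  assumes "norm y = 1"
  shows "norm (s - (s \<bullet> y) *\<^sub>R y) \<le> norm s" "(s - (s \<bullet> y) *\<^sub>R y) \<bullet> y = 0"
proof -
  have yy: "y \<bullet> y = 1" using assms by (simp add: norm_eq_1)
  have "(norm (s - (s \<bullet> y) *\<^sub>R y))\<^sup>2 = (norm s)\<^sup>2 - (s \<bullet> y)\<^sup>2"
    unfolding power2_norm_eq_inner
    by (simp add: inner_simps yy inner_commute[of y s] power2_eq_square)
  also have "\<dots> \<le> (norm s)\<^sup>2" by simp
  finally show "norm (s - (s \<bullet> y) *\<^sub>R y) \<le> norm s" by (rule power2_le_imp_le) simp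
  show "(s - (s \<bullet> y) *\<^sub>R y) \<bullet> y = 0" by (simp add: inner_simps yy)
qed

text \<open>
  For fixed \<open>y\<close> the point \<open>a x = - u + h y\<close> runs over the graph of \<open>h = sqrt (a\<^sup>2 - |u|\<^sup>2)\<close> above the
  ball of radius \<open>r\<close>, where the slope is at most 1; this is the source of the constant \<open>sqrt 2\<close>.
\<close>

lemma sphere_preimage_Lipschitz:
  fixes x x' s s' :: "'a::real_inner"
  assumes x: "norm x = 1" "norm x' = 1" and s: "norm s \<le> r" "norm s' \<le> r" and r: "sqrt 2 * r < a"
  shows "norm (x - x') \<le> sqrt 2 / a * norm (s - s') + 5 * norm (sgn (a *\<^sub>R x + s) - sgn (a *\<^sub>R x' + s'))"
proof -
  define y y' where "y = sgn (a *\<^sub>R x + s)" and "y' = sgn (a *\<^sub>R x' + s')"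
  \<comment> \<open>\<open>w\<close> is the intermediate point: \<open>u - w\<close> varies
    \<open>s\<close> with \<open>y\<close> fixed, and \<open>w - u'\<close> varies \<open>y\<close>
    with \<open>s'\<close> fixed.\<close>
  define u u' w where "u = s - (s \<bullet> y) *\<^sub>R y" and "u' = s' - (s' \<bullet> y') *\<^sub>R y'"
    and "w = s' - (s' \<bullet> y) *\<^sub>R y"
  define h where "h v = sqrt (a\<^sup>2 - (norm v)\<^sup>2)" for v :: 'a
  have r0: "0 \<le> r" using s norm_ge_zero order_trans by blast
  have ra: "r < a" 
  proof -
    have "1 * r \<le> sqrt 2 * r" using r0 by (intro mult_right_mono) auto
    then show ?thesis using r by simp
  qed
  then have a: "0 < a" using r0 by simp
  have "(sqrt 2 * r)\<^sup>2 \<le> a\<^sup>2" using r r0 by (intro power_mono) auto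
  then have r2: "2 * r\<^sup>2 \<le> a\<^sup>2" by (simp add: power_mult_distrib)
  have dec: "a *\<^sub>R x = - u + h u *\<^sub>R y" "norm y = 1" "a *\<^sub>R x' = - u' + h u' *\<^sub>R y'" "norm y' = 1"
    using sphere_decomposition[OF x(1), of s a] sphere_decomposition[OF x(2), of s' a] s ra
    unfolding h_def u_def u'_def y_def y'_def by auto
  have le_r: "norm u \<le> r" "norm u' \<le> r" "norm w \<le> r"
    using norm_orthogonal_part_le(1)[OF dec(2), of s] norm_orthogonal_part_le(1)[OF dec(4), of s']
      norm_orthogonal_part_le(1)[OF dec(2), of s'] s
    unfolding u_def u'_def w_def by linarith+
  have hL: "\<bar>h v - h v'\<bar> \<le> norm (v - v')" if "norm v \<le> r" "norm v' \<le> r" for v v'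
  proof -
    have "\<bar>h v - h v'\<bar> \<le> \<bar>norm v - norm v'\<bar>"
      unfolding h_def using that by (intro sqrt_diff_squares_Lipschitz[OF a _ _ _ _ r2]) auto
    also have "\<dots> \<le> norm (v - v')" by (rule norm_triangle_ineq3)
    finally show ?thesis .
  qed
  define z where "z = u - w"
  have zeq: "z = (s - s') - ((s - s') \<bullet> y) *\<^sub>R y"
    by (simp add: z_def u_def w_def inner_simps algebra_simps)
  have z: "norm z \<le> norm (s - s')" "z \<bullet> y = 0"
    unfolding zeq by (rule norm_orthogonal_part_le[OF dec(2)])+
  have yy: "y \<bullet> y = 1" using dec(2) by (simp add: norm_eq_1)
  \<comment> \<open>As \<open>z\<close> is orthogonal to \<open>y\<close>, Pythagoras yields the
    factor \<open>sqrt 2\<close>, where the triangle inequality would give 2.\<close>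
  have "(norm (- z + (h u - h w) *\<^sub>R y))\<^sup>2 = (norm z)\<^sup>2 + (h u - h w)\<^sup>2"
    unfolding power2_norm_eq_inner using z(2)
    by (simp add: inner_simps yy inner_commute[of y z] power2_eq_square)
  also have "\<dots> \<le> (norm z)\<^sup>2 + (norm z)\<^sup>2"
    using hL[OF le_r(1,3)] abs_le_square_iff[of "h u - h w" "norm (u - w)"] by (simp add: z_def)
  also have "\<dots> \<le> (sqrt 2 * norm (s - s'))\<^sup>2"
    using power_mono[OF z(1), of 2] by (simp add: power_mult_distrib)
  finally have b1: "norm (- z + (h u - h w) *\<^sub>R y) \<le> sqrt 2 * norm (s - s')"
    by (rule power2_le_imp_le) simp
  define e where "e = norm (y - y')"
  have "w - u' = - ((s' \<bullet> y) *\<^sub>R (y - y')) - (s' \<bullet> (y - y')) *\<^sub>R y'"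
    by (simp add: w_def u'_def inner_simps algebra_simps)
  then have "norm (w - u') \<le> \<bar>s' \<bullet> y\<bar> * e + \<bar>s' \<bullet> (y - y')\<bar>"
    using norm_triangle_ineq4[of "- ((s' \<bullet> y) *\<^sub>R (y - y'))" "(s' \<bullet> (y - y')) *\<^sub>R y'"] dec(4)
    by (simp add: e_def)
  also have "\<dots> \<le> r * e + r * e"
  proof (intro add_mono mult_right_mono)
    show "\<bar>s' \<bullet> y\<bar> \<le> r" using Cauchy_Schwarz_ineq2[of s' y] dec(2) s(2) by simp
    have "\<bar>s' \<bullet> (y - y')\<bar> \<le> norm s' * e" using Cauchy_Schwarz_ineq2 by (simp add: e_def)
    also have "\<dots> \<le> r * e" using s(2) by (intro mult_right_mono) (auto simp: e_def)
    finally show "\<bar>s' \<bullet> (y - y')\<bar> \<le> r * e" .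
  qed (simp add: e_def)
  also have "\<dots> \<le> a * e + a * e" using ra by (intro add_mono mult_right_mono) (auto simp: e_def)
  finally have b2: "norm (w - u') \<le> 2 * (a * e)" by simp
  have b3: "\<bar>h w - h u'\<bar> \<le> 2 * (a * e)" using hL[OF le_r(3,2)] b2 by simp
  have b4: "\<bar>h u'\<bar> * e \<le> a * e"
  proof (intro mult_right_mono)
    have "(norm u')\<^sup>2 \<le> r\<^sup>2" using le_r(2) by (intro power_mono) auto
    then have "0 \<le> a\<^sup>2 - (norm u')\<^sup>2" using r2 zero_le_power2[of r] by linarith
    then show "\<bar>h u'\<bar> \<le> a" using a by (auto simp: h_def intro!: real_le_lsqrt)
  qed (simp add: e_def)
  have "a * norm (x - x') = norm (a *\<^sub>R x - a *\<^sub>R x')"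
    using a by (simp add: scaleR_diff_right[symmetric])
  also have "a *\<^sub>R x - a *\<^sub>R x' =
      (- z + (h u - h w) *\<^sub>R y) + ((u' - w) + ((h w - h u') *\<^sub>R y + h u' *\<^sub>R (y - y')))"
    by (simp add: dec(1,3) z_def algebra_simps)
  \<comment> \<open>The constant 5 is 2 + 2 + 1, from \<open>b2\<close>, \<open>b3\<close> and
    \<open>b4\<close>.\<close>
  also have "norm \<dots> \<le> sqrt 2 * norm (s - s') + (2 * (a * e) + (2 * (a * e) + a * e))"
    using b2 b3 b4 dec(2)
    by (intro norm_triangle_le[OF add_mono[OF b1 norm_triangle_le[OF add_mono[OF _ norm_triangle_le[OF add_mono]]]]])
      (auto simp: norm_minus_commute e_def)
  finally have "norm (x - x') \<le> (sqrt 2 * norm (s - s') + 5 * (a * e)) / a"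
    using a by (simp add: pos_le_divide_eq mult.commute)
  then show ?thesis
    using a by (simp add: add_divide_distrib e_def y_def y'_def)
qed

subsection \<open>Expansion of a quadratic form\<close>

locale self_adjoint_form =
  fixes G :: "'a::euclidean_space \<Rightarrow> 'a \<Rightarrow> real" and L :: "'a \<Rightarrow> 'a" and g :: real
  assumes bilinear: "bounded_bilinear G"
    and commute: "G u v = G v u"
    and g: "0 < g" "g * (norm v)\<^sup>2 \<le> G v v"
    and linear: "linear L"
    and adjoint: "G (L u) v = G u (L v)"
    and nonneg: "0 \<le> G (L v) v"
begin

interpretation G: bounded_bilinear G by (rule bilinear)
interpretation L: linear L by (rule linear)

lemma pos: "v \<noteq> 0 \<Longrightarrow> 0 < G v v"
  using g(1) g(2)[of v] by (metis less_le_trans mult_pos_pos zero_less_norm_iff zero_less_power)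

text \<open>Eigenvectors of different eigenvalues are \<open>G\<close>-orthogonal, hence
  independent, so an interval consisting of eigenvalues would give an infinite independent
  set.\<close>

lemma ex_non_eigenvalue:
  assumes "a < b"
  obtains \<theta> where "a < \<theta>" "\<theta> < b" "\<And>v. L v = \<theta> *\<^sub>R v \<Longrightarrow> v = 0"
proof (rule ccontr)
  assume "\<not> thesis"
  then have "\<forall>\<theta>\<in>{a<..<b}. \<exists>v. v \<noteq> 0 \<and> L v = \<theta> *\<^sub>R v"
    using that by (metis greaterThanLessThan_iff)
  then obtain w where w: "\<And>\<theta>. \<theta> \<in> {a<..<b} \<Longrightarrow> w \<theta> \<noteq> 0 \<and> L (w \<theta>) = \<theta> *\<^sub>R w \<theta>"
    by metis
  have orth: "G (w \<theta>) (w \<eta>) = 0" if "\<theta> \<in> {a<..<b}" "\<eta> \<in> {a<..<b}" "\<theta> \<noteq> \<eta>" for \<theta> \<eta>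
    using adjoint[of "w \<theta>" "w \<eta>"] w that by (auto simp: G.scaleR_left G.scaleR_right)
  have inj: "inj_on w {a<..<b}"
    using orth w pos by (metis inj_onI less_irrefl)
  have "independent (w ` {a<..<b})"
    unfolding dependent_def
  proof clarify
    fix \<theta> assume \<theta>: "\<theta> \<in> {a<..<b}" and span: "w \<theta> \<in> span (w ` {a<..<b} - {w \<theta>})"
    have "subspace {v. G (w \<theta>) v = 0}"
      by (auto simp: subspace_def G.add_right G.scaleR_right G.zero_right)
    moreover have "w ` {a<..<b} - {w \<theta>} \<subseteq> {v. G (w \<theta>) v = 0}"
    proof
      fix y assume "y \<in> w ` {a<..<b} - {w \<theta>}"
      then obtain \<eta> where "\<eta> \<in> {a<..<b}" "y = w \<eta>" "\<theta> \<noteq> \<eta>" by blast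
      then show "y \<in> {v. G (w \<theta>) v = 0}" using orth[OF \<theta>] by simp
    qed
    ultimately have "w \<theta> \<in> {v. G (w \<theta>) v = 0}"
      using span span_minimal by blast
    then show False using pos[of "w \<theta>"] w[OF \<theta>] by simp
  qed
  then have "finite (w ` {a<..<b})" by (rule independent_imp_finite)
  then show False using finite_imageD[OF _ inj] infinite_Ioo[OF assms] by blast
qed

definition Q :: "real \<Rightarrow> 'a \<Rightarrow> real" where
  "Q \<theta> v = G (L v) v - \<theta> * G v v"

lemma Q_scaleR: "Q \<theta> (c *\<^sub>R v) = c\<^sup>2 * Q \<theta> v"
  by (simp add: Q_def L.scaleR G.scaleR_left G.scaleR_right algebra_simps power2_eq_square)

text \<open>By self-adjointness this is the polynomial identity \<open>t^2 (t - \<theta>) -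
  \<theta>^2 (t - \<theta>) = (t + \<theta>) (t - \<theta>)^2\<close> evaluated at
  \<open>L\<close>.\<close>

lemma Q_image:
  fixes \<theta> v defines "w \<equiv> L v - \<theta> *\<^sub>R v"
  shows "Q \<theta> (L v) = \<theta>\<^sup>2 * Q \<theta> v + G (L w) w + \<theta> * G w w"
  using commute[of v "L (L v)"] commute[of v "L v"] adjoint[of "L v" "L v"] adjoint[of "L v" v] adjoint[of "L (L v)" v]
  by (simp add: Q_def w_def L.diff L.scaleR G.diff_left G.diff_right G.scaleR_left G.scaleR_right
      algebra_simps power2_eq_square)

text \<open>
  The form \<open>Q\<close> grows by the factor \<open>\<theta>\<^sup>2\<close> under \<open>L\<close>, and by \<open>Q_image\<close> with a margin proportional to
  \<open>(norm v)\<^sup>2\<close> once \<open>\<theta>\<close> is not an eigenvalue; the margin absorbs the nonlinear error.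
\<close>

lemma Q_expanding:
  assumes "0 < \<theta>" and inj: "\<And>v. L v = \<theta> *\<^sub>R v \<Longrightarrow> v = 0"
  obtains \<epsilon> where "0 < \<epsilon>" "\<And>v v'. norm (v' - L v) \<le> \<epsilon> * norm v \<Longrightarrow> \<theta>\<^sup>2 * Q \<theta> v \<le> Q \<theta> v'"
proof -
  let ?R = "\<lambda>u v. G (L u) v - \<theta> * G u v"
  have lin: "linear (\<lambda>v. L v - \<theta> *\<^sub>R v)"
    by (intro linear_compose_sub linear linear_scaleR)
  then have "inj (\<lambda>v. L v - \<theta> *\<^sub>R v)"
    using inj by (simp add: linear_injective_0)
  from linear_inj_bounded_below_pos[OF lin this]
  obtain c where c: "c > 0" "\<And>v. c * norm v \<le> norm (L v - \<theta> *\<^sub>R v)" by metis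
  obtain K where K: "K > 0" "\<And>u v. \<bar>G u v\<bar> \<le> norm u * norm v * K"
    using G.pos_bounded by (metis real_norm_def)
  obtain B where B: "B > 0" "\<And>u. norm (L u) \<le> B * norm u"
    using linear_bounded_pos[OF linear] by metis
  define K' where "K' = (B + \<theta>) * K"
  have K': "K' > 0" using B K assms by (simp add: K'_def)
  have R: "\<bar>?R u v\<bar> \<le> K' * norm u * norm v" for u v
  proof -
    have "\<bar>?R u v\<bar> \<le> \<bar>G (L u) v\<bar> + \<theta> * \<bar>G u v\<bar>"
      using assms(1) abs_triangle_ineq4[of "G (L u) v" "\<theta> * G u v"] by (simp add: abs_mult)
    also have "\<dots> \<le> (B * norm u) * norm v * K + \<theta> * (norm u * norm v * K)"
      using K assms(1) B(2)[of u]
      by (intro add_mono mult_left_mono order_trans[OF K(2)] mult_right_mono) auto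
    finally show ?thesis by (simp add: K'_def algebra_simps)
  qed
  define m where "m = \<theta> * (g * c\<^sup>2)"
  have m: "m > 0" using assms(1) g(1) c(1) by (simp add: m_def)
  have main: "\<theta>\<^sup>2 * Q \<theta> v + m * (norm v)\<^sup>2 \<le> Q \<theta> (L v)" for v
  proof -
    define w where "w = L v - \<theta> *\<^sub>R v"
    have "(c * norm v)\<^sup>2 \<le> (norm w)\<^sup>2" using c by (intro power_mono) (auto simp: w_def)
    then have "g * (c * norm v)\<^sup>2 \<le> G w w"
      using g(1) g(2)[of w] by (meson mult_le_cancel_left_pos order_trans)
    then have "m * (norm v)\<^sup>2 \<le> \<theta> * G w w"
      using assms(1) by (simp add: m_def power_mult_distrib mult.assoc)
    then show ?thesis using Q_image[of \<theta> v] nonneg[of w] by (simp add: w_def)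
  qed
  \<comment> \<open>The cap 1 gives \<open>norm d \<le> norm v\<close>, so the term quadratic in
    \<open>d\<close> is also bounded by a multiple of \<epsilon>; the quotient then makes the total
    error at most \<open>m * (norm v)\<^sup>2\<close>.\<close>
  define \<epsilon> where "\<epsilon> = min 1 (m / (2 * K' * B + K'))"
  have D: "2 * K' * B + K' > 0" using K' B by (simp add: add_pos_pos)
  have eps: "0 < \<epsilon>" "\<epsilon> \<le> 1" "\<epsilon> * (2 * K' * B + K') \<le> m"
    using m D pos_le_divide_eq[OF D, of \<epsilon> m] by (auto simp: \<epsilon>_def)
  show thesis
  proof (rule that[OF eps(1)])
    fix v v' assume v': "norm (v' - L v) \<le> \<epsilon> * norm v"
    define d where "d = v' - L v"
    have d: "norm d \<le> \<epsilon> * norm v" "norm d \<le> norm v"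
      using v' eps(2) mult_right_mono[OF eps(2), of "norm v"] by (auto simp: d_def)
    have "v' = L v + d" by (simp add: d_def)
    then have eq: "Q \<theta> v' = Q \<theta> (L v) + 2 * ?R (L v) d + ?R d d"
      using adjoint[of d "L v"] commute[of d "L (L v)"] commute[of d "L v"]
      by (simp add: Q_def L.add G.add_left G.add_right algebra_simps)
    have "\<bar>?R (L v) d\<bar> \<le> K' * (B * norm v) * (\<epsilon> * norm v)"
      using K' B d by (intro order_trans[OF R] mult_mono mult_left_mono) auto
    moreover have "\<bar>?R d d\<bar> \<le> K' * norm v * (\<epsilon> * norm v)"
      using K' d eps by (intro order_trans[OF R] mult_mono mult_left_mono) auto
    ultimately have "2 * \<bar>?R (L v) d\<bar> + \<bar>?R d d\<bar> \<le> (\<epsilon> * (2 * K' * B + K')) * (norm v)\<^sup>2"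
      by (simp add: algebra_simps power2_eq_square)
    also have "\<dots> \<le> m * (norm v)\<^sup>2" using eps(3) by (intro mult_right_mono) auto
    finally have "2 * \<bar>?R (L v) d\<bar> + \<bar>?R d d\<bar> \<le> m * (norm v)\<^sup>2" .
    then show "\<theta>\<^sup>2 * Q \<theta> v \<le> Q \<theta> v'"
      using main[of v] eq abs_ge_minus_self[of "?R (L v) d"] abs_ge_minus_self[of "?R d d"] by argo
  qed
qed

text \<open>Choose \<theta> between 1 and the Rayleigh quotient of \<open>e\<close>, away from the
  spectrum. Then \<open>Q \<theta>\<close> is positive on a ball about \<open>e\<close>, hence, by
  homogeneity, on the double cone over it. A sequence starting in that cone would have
  \<open>Q \<theta>\<close> growing geometrically, which boundedness excludes.\<close>

lemma unstable_separation:
  assumes e: "G e e < G (L e) e"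
  obtains \<epsilon> \<eta> where "0 < \<epsilon>" "0 < \<eta>"
    "\<And>v c. \<lbrakk>\<And>k. norm (v (Suc k) - L (v k)) \<le> \<epsilon> * norm (v k); bounded (range v)\<rbrakk>
       \<Longrightarrow> \<eta> * \<bar>c\<bar> \<le> norm (v 0 - c *\<^sub>R e)"
proof -
  have "e \<noteq> 0" using e by (auto simp: L.zero G.zero_left)
  then have Ge: "0 < G e e" by (rule pos)
  then have "1 < G (L e) e / G e e" using e by simp
  then obtain \<theta> where \<theta>: "1 < \<theta>" "\<theta> < G (L e) e / G e e" "\<And>v. L v = \<theta> *\<^sub>R v \<Longrightarrow> v = 0"
    using ex_non_eigenvalue by metis
  then obtain \<epsilon> where \<epsilon>: "0 < \<epsilon>" "\<And>v v'. norm (v' - L v) \<le> \<epsilon> * norm v \<Longrightarrow> \<theta>\<^sup>2 * Q \<theta> v \<le> Q \<theta> v'"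
    using Q_expanding[of \<theta>] by (metis less_trans zero_less_one)
  have Qe: "0 < Q \<theta> e" using \<theta>(2) Ge by (simp add: Q_def pos_less_divide_eq)
  have "continuous_on UNIV (Q \<theta>)"
    unfolding Q_def
    by (intro continuous_intros G.continuous_on linear_continuous_on linear linear_conv_bounded_linear[THEN iffD1])
  then have "open {v. 0 < Q \<theta> v}"
    by (simp add: open_Collect_less continuous_on_const)
  then obtain \<eta> where \<eta>: "0 < \<eta>" "ball e \<eta> \<subseteq> {v. 0 < Q \<theta> v}"
    using Qe by (metis mem_Collect_eq open_contains_ball)
  have bounded_nonpos: "Q \<theta> (v 0) \<le> 0"
    if step: "\<And>k. norm (v (Suc k) - L (v k)) \<le> \<epsilon> * norm (v k)" and bdd: "bounded (range v)" for v
  proof (rule ccontr)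
    assume "\<not> Q \<theta> (v 0) \<le> 0"
    then have pos: "0 < Q \<theta> (v 0)" by simp
    have grow: "(\<theta>\<^sup>2) ^ k * Q \<theta> (v 0) \<le> Q \<theta> (v k)" for k
    proof (induction k)
      case (Suc k)
      have "(\<theta>\<^sup>2) ^ Suc k * Q \<theta> (v 0) \<le> \<theta>\<^sup>2 * Q \<theta> (v k)"
        using Suc by (simp add: mult.assoc mult_left_mono)
      also have "\<dots> \<le> Q \<theta> (v (Suc k))" using \<epsilon>(2) step by blast
      finally show ?case .
    qed simp
    have "compact (closure (range v))" using bdd by simp
    then have "compact (Q \<theta> ` closure (range v))"
      using \<open>continuous_on UNIV (Q \<theta>)\<close> by (metis compact_continuous_image continuous_on_subset top_greatest)
    then obtain C where C: "\<And>x. x \<in> closure (range v) \<Longrightarrow> \<bar>Q \<theta> x\<bar> \<le> C"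
      by (metis (no_types, opaque_lifting) bounded_iff compact_imp_bounded imageI real_norm_def)
    have "1 < \<theta>\<^sup>2" using \<theta>(1) by (simp add: one_less_power)
    then obtain k where "C / Q \<theta> (v 0) < (\<theta>\<^sup>2) ^ k" using real_arch_pow by blast
    then have "C < (\<theta>\<^sup>2) ^ k * Q \<theta> (v 0)" using pos by (simp add: pos_divide_less_eq)
    moreover have "\<bar>Q \<theta> (v k)\<bar> \<le> C" by (intro C closure_subset[THEN subsetD]) auto
    ultimately show False using grow[of k] by linarith
  qed
  show thesis
  proof (rule that[OF \<epsilon>(1) \<eta>(1)])
    fix v c assume v: "\<And>k. norm (v (Suc k) - L (v k)) \<le> \<epsilon> * norm (v k)" "bounded (range v)"
    show "\<eta> * \<bar>c\<bar> \<le> norm (v 0 - c *\<^sub>R e)"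
    proof (rule ccontr)
      assume "\<not> \<eta> * \<bar>c\<bar> \<le> norm (v 0 - c *\<^sub>R e)"
      then have less: "norm (v 0 - c *\<^sub>R e) < \<eta> * \<bar>c\<bar>" by simp
      then have c: "c \<noteq> 0" by (auto simp: not_less)
      have "v 0 - c *\<^sub>R e = c *\<^sub>R (inverse c *\<^sub>R v 0 - e)"
        using c by (simp add: scaleR_diff_right)
      then have "norm (inverse c *\<^sub>R v 0 - e) < \<eta>"
        using less c by (simp add: mult.commute)
      then have "0 < Q \<theta> (inverse c *\<^sub>R v 0)"
        using \<eta>(2) by (auto simp: dist_norm norm_minus_commute)
      then show False using bounded_nonpos[OF v] c by (simp add: Q_scaleR zero_less_mult_iff)
    qed
  qed
qed

end

section \<open>Strict differentiability of normalization\<close>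

definition sgn_deriv :: "'a::real_inner \<Rightarrow> 'a \<Rightarrow> 'a" where
  "sgn_deriv p v = (v - (v \<bullet> sgn p) *\<^sub>R sgn p) /\<^sub>R norm p"

text \<open>Both points move, because the estimate is applied to differences of two orbits. The
  error is written as \<open>norm (p - q)\<close> times a factor that is continuous at
  \<open>(p0, p0)\<close> and vanishes there.\<close>

lemma sgn_strictly_differentiable:
  fixes p0 :: "'a::real_inner"
  assumes "p0 \<noteq> 0" "0 < \<epsilon>"
  obtains \<delta> where "0 < \<delta>" "\<And>p q. \<lbrakk>norm (p - p0) < \<delta>; norm (q - p0) < \<delta>\<rbrakk>
    \<Longrightarrow> norm (sgn p - sgn q - sgn_deriv p0 (p - q)) \<le> \<epsilon> * norm (p - q)"
proof -
  \<comment> \<open>\<open>m\<close> makes the difference of norms exactly linear,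
    \<open>norm p - norm q = (p - q) \<bullet> m (p, q)\<close>, and it tends to
    \<open>sgn p0\<close>.\<close>
  define m where "m z = (fst z + snd z) /\<^sub>R (norm (fst z) + norm (snd z))" for z :: "'a \<times> 'a"
  let ?F = "nhds (p0, p0)"
  let ?E = "\<lambda>z. \<bar>inverse (norm (fst z)) - inverse (norm p0)\<bar>
      + norm (m z /\<^sub>R norm (fst z) - sgn p0 /\<^sub>R norm p0)
      + norm (sgn p0 /\<^sub>R norm p0) * norm (sgn (snd z) - sgn p0)"
  have fs: "(fst \<longlongrightarrow> p0) ?F" "(snd \<longlongrightarrow> p0) ?F"
    using tendsto_fst[OF filterlim_ident] tendsto_snd[OF filterlim_ident] by fastforce+
  have n: "norm p0 \<noteq> 0" "norm p0 + norm p0 \<noteq> 0" using assms(1) by auto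
  have "(m \<longlongrightarrow> (p0 + p0) /\<^sub>R (norm p0 + norm p0)) ?F"
    unfolding m_def by (intro tendsto_intros fs n)
  also have "(p0 + p0) /\<^sub>R (norm p0 + norm p0) = sgn p0"
    using n by (simp add: sgn_div_norm scaleR_2[symmetric] mult_2[symmetric] del: mult_2 scaleR_2)
  finally have m: "(m \<longlongrightarrow> sgn p0) ?F" .
  have "(?E \<longlongrightarrow> \<bar>inverse (norm p0) - inverse (norm p0)\<bar>
      + norm (sgn p0 /\<^sub>R norm p0 - sgn p0 /\<^sub>R norm p0)
      + norm (sgn p0 /\<^sub>R norm p0) * norm (sgn p0 - sgn p0)) ?F"
    by (intro tendsto_intros fs m n tendsto_sgn assms(1))
  then have "(?E \<longlongrightarrow> 0) ?F" by simp
  then have "eventually (\<lambda>z. ?E z < \<epsilon>) ?F"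
    using assms(2) by (rule order_tendstoD(2))
  moreover have "eventually (\<lambda>z. fst z \<noteq> 0) ?F" "eventually (\<lambda>z. snd z \<noteq> 0) ?F"
    using fs assms(1) by (auto intro: tendsto_imp_eventually_ne)
  ultimately have "eventually (\<lambda>z. ?E z < \<epsilon> \<and> fst z \<noteq> 0 \<and> snd z \<noteq> 0) ?F"
    by (auto intro: eventually_conj)
  then obtain S where S: "open S" "(p0, p0) \<in> S" "\<And>z. z \<in> S \<Longrightarrow> ?E z < \<epsilon> \<and> fst z \<noteq> 0 \<and> snd z \<noteq> 0"
    unfolding eventually_nhds by blast
  obtain A B where AB: "open A" "open B" "p0 \<in> A" "p0 \<in> B" "A \<times> B \<subseteq> S"
    using open_prod_elim[OF S(1,2)] by (metis mem_Sigma_iff)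
  then have "open (A \<inter> B)" "p0 \<in> A \<inter> B" by auto
  then obtain \<delta> where \<delta>: "0 < \<delta>" "ball p0 \<delta> \<subseteq> A \<inter> B" by (meson open_contains_ball)
  show thesis
  proof (rule that[OF \<delta>(1)])
    fix p q assume "norm (p - p0) < \<delta>" "norm (q - p0) < \<delta>"
    then have "p \<in> ball p0 \<delta>" "q \<in> ball p0 \<delta>" by (simp_all add: dist_norm norm_minus_commute)
    then have "(p, q) \<in> S" using \<delta>(2) AB(5) by blast
    then have E: "?E (p, q) < \<epsilon>" and nz: "p \<noteq> 0" "q \<noteq> 0" using S(3)[of "(p, q)"] by auto
    define v u M a b where "v = p - q" and "u = sgn p0" and "M = m (p, q)"
      and "a = inverse (norm p)" and "b = inverse (norm p0)"
    have ab: "a \<noteq> 0" "a * norm p = 1" using nz by (auto simp: a_def)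
    have "(norm p - norm q) * (norm p + norm q) = v \<bullet> (p + q)"
      by (simp add: v_def inner_simps algebra_simps inner_commute flip: power2_norm_eq_inner power2_eq_square)
    moreover have "norm p + norm q > 0" using nz by (simp add: add_pos_pos)
    ultimately have "norm p - norm q = v \<bullet> (p + q) / (norm p + norm q)"
      by (metis less_irrefl nonzero_eq_divide_eq)
    also have "\<dots> = v \<bullet> M" by (simp add: M_def m_def divide_inverse mult.commute)
    finally have nn: "norm p - norm q = v \<bullet> M" .
    have "sgn p - sgn q = a *\<^sub>R (v - (v \<bullet> M) *\<^sub>R sgn q)"
    proof -
      have "q = norm q *\<^sub>R sgn q" using nz by (simp add: sgn_div_norm)
      then have "v - (v \<bullet> M) *\<^sub>R sgn q = p - norm p *\<^sub>R sgn q"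
        by (metis nn v_def scaleR_diff_left diff_diff_eq2 diff_add_cancel)
      then show ?thesis using ab(2) by (simp add: scaleR_diff_right sgn_div_norm a_def)
    qed
    moreover have "sgn_deriv p0 v = b *\<^sub>R (v - (v \<bullet> u) *\<^sub>R u)"
      by (simp add: sgn_deriv_def u_def b_def)
    \<comment> \<open>The three terms correspond to the three summands of \<open>?E\<close>.\<close>
    ultimately have "sgn p - sgn q - sgn_deriv p0 v =
      (a - b) *\<^sub>R v - (v \<bullet> (a *\<^sub>R M - b *\<^sub>R u)) *\<^sub>R sgn q - (v \<bullet> (b *\<^sub>R u)) *\<^sub>R (sgn q - u)"
      by (simp add: algebra_simps inner_simps)
    also have "norm \<dots> \<le> \<bar>a - b\<bar> * norm v + norm v * norm (a *\<^sub>R M - b *\<^sub>R u)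
        + norm v * norm (b *\<^sub>R u) * norm (sgn q - u)"
    proof (intro norm_triangle_le_diff[OF add_mono[OF norm_triangle_le_diff[OF add_mono]]])
      show "norm ((v \<bullet> (a *\<^sub>R M - b *\<^sub>R u)) *\<^sub>R sgn q) \<le> norm v * norm (a *\<^sub>R M - b *\<^sub>R u)"
        using Cauchy_Schwarz_ineq2[of v "a *\<^sub>R M - b *\<^sub>R u"] nz by (simp add: norm_sgn)
      show "norm ((v \<bullet> (b *\<^sub>R u)) *\<^sub>R (sgn q - u)) \<le> norm v * norm (b *\<^sub>R u) * norm (sgn q - u)"
        using Cauchy_Schwarz_ineq2[of v "b *\<^sub>R u"] unfolding norm_scaleR real_norm_def
        by (intro mult_right_mono) auto
    qed simp
    also have "\<dots> = ?E (p, q) * norm v"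
      by (simp add: a_def b_def u_def M_def algebra_simps)
    also have "\<dots> \<le> \<epsilon> * norm v" using E by (intro mult_right_mono) auto
    finally show "norm (sgn p - sgn q - sgn_deriv p0 (p - q)) \<le> \<epsilon> * norm (p - q)"
      by (simp add: v_def)
  qed
qed

subsection \<open>The product surface measure as a cone measure\<close>

lemma vec_lambda_measurable_PiM:
  "vec_lambda \<in> PiM UNIV (\<lambda>_::'n::finite. lborel :: 'a::euclidean_space measure) \<rightarrow>\<^sub>M borel"
    (is "_ \<in> ?M \<rightarrow>\<^sub>M _")
proof (rule borel_measurable_euclidean_space[THEN iffD2], rule ballI)
  fix b :: "'a ^ 'n" assume "b \<in> Basis"
  then obtain i and u :: 'a where b: "b = axis i u"
    by (auto simp: Basis_vec_def)
  have "(\<lambda>g. g i) \<in> ?M \<rightarrow>\<^sub>M lborel"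
    by (rule measurable_component_singleton) simp
  then have "(\<lambda>g. g i) \<in> borel_measurable ?M" by simp
  then have "(\<lambda>g. g i \<bullet> u) \<in> borel_measurable ?M"
    by (intro borel_measurable_inner) auto
  then show "(\<lambda>g. vec_lambda g \<bullet> b) \<in> borel_measurable ?M"
    by (simp add: b inner_axis)
qed

text \<open>Lebesgue measure on stacked vectors is the product of the Lebesgue measures of the
  components. It is enough to compare boxes, since the basis vectors are the \<open>axis i b\<close>
  and the side lengths multiply out over pairs.\<close>

lemma lborel_vec:
  "(lborel :: ('a::euclidean_space ^ 'n::finite) measure) = distr (PiM UNIV (\<lambda>_. lborel)) borel vec_lambda"
proof (rule lborel_eqI)
  interpret finite_product_sigma_finite "\<lambda>_::'n. lborel :: 'a measure" UNIV
    by standard auto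
  fix l u :: "'a ^ 'n" assume le: "\<And>b. b \<in> Basis \<Longrightarrow> l \<bullet> b \<le> u \<bullet> b"
  have le': "l $ i \<bullet> b \<le> u $ i \<bullet> b" if "b \<in> Basis" for i b
    using le[of "axis i b"] that by (auto simp: inner_axis Basis_vec_def)
  have "vec_lambda -` box l u \<inter> space (PiM UNIV (\<lambda>_. lborel)) = PiE UNIV (\<lambda>i. box (l $ i) (u $ i))"
    by (auto simp: space_PiM PiE_def Pi_def box_def Basis_vec_def inner_axis)
  then have "emeasure (distr (PiM UNIV (\<lambda>_. lborel)) borel vec_lambda) (box l u)
      = emeasure (PiM UNIV (\<lambda>_. lborel)) (PiE UNIV (\<lambda>i. box (l $ i) (u $ i)))"
    by (simp add: emeasure_distr[OF vec_lambda_measurable_PiM])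
  also have "\<dots> = (\<Prod>i\<in>UNIV. emeasure lborel (box (l $ i) (u $ i)))"
    by (intro measure_times) auto
  also have "\<dots> = (\<Prod>i\<in>UNIV. ennreal (\<Prod>b\<in>Basis. (u $ i - l $ i) \<bullet> b))"
    using le' by (intro prod.cong) (auto simp: emeasure_lborel_box)
  also have "\<dots> = ennreal (\<Prod>i\<in>UNIV. \<Prod>b\<in>Basis. (u $ i - l $ i) \<bullet> b)"
    using le' by (intro prod_ennreal prod_nonneg) (auto simp: inner_diff_left)
  also have "(\<Prod>i\<in>UNIV. \<Prod>b\<in>Basis. (u $ i - l $ i) \<bullet> b)
      = (\<Prod>(i, b)\<in>UNIV \<times> Basis. (u - l) \<bullet> axis i b)"
    by (simp add: prod.cartesian_product inner_axis)
  also have "\<dots> = (\<Prod>b\<in>Basis. (u - l) \<bullet> b)"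
  proof -
    have "bij_betw (\<lambda>(i, b). axis i b) (UNIV \<times> (Basis :: 'a set)) (Basis :: ('a ^ 'n) set)"
      by (auto simp: bij_betw_def inj_on_def Basis_vec_def axis_eq_axis)
    from prod.reindex_bij_betw[OF this, of "\<lambda>b. (u - l) \<bullet> b"] show ?thesis
      by (simp add: case_prod_unfold)
  qed
  finally show "emeasure (distr (PiM UNIV (\<lambda>_. lborel)) borel vec_lambda) (box l u)
      = (\<Prod>b\<in>Basis. (u - l) \<bullet> b)" .
qed simp

lemma borel_vec_box:
  fixes B :: "'n::finite \<Rightarrow> 'a::euclidean_space set"
  assumes "\<And>i. B i \<in> sets borel"
  shows "{x :: 'a ^ 'n. \<forall>i. x $ i \<in> B i} \<in> sets borel"
proof -
  have "(\<lambda>x :: 'a ^ 'n. x $ i) -` B i \<in> sets borel" for i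
    using measurable_sets[of "\<lambda>x :: 'a ^ 'n. x $ i" borel borel "B i"] assms
    by (simp add: borel_measurable_continuous_onI continuous_on_component)
  then have "(\<Inter>i. (\<lambda>x :: 'a ^ 'n. x $ i) -` B i) \<in> sets borel"
    by (intro sets.finite_INT) auto
  moreover have "(\<Inter>i. (\<lambda>x :: 'a ^ 'n. x $ i) -` B i) = {x. \<forall>i. x $ i \<in> B i}" by auto
  ultimately show ?thesis by simp
qed

lemma emeasure_lborel_vec_box:
  fixes B :: "'n::finite \<Rightarrow> 'a::euclidean_space set"
  assumes "\<And>i. B i \<in> sets borel"
  shows "emeasure lborel {x. \<forall>i. x $ i \<in> B i} = (\<Prod>i\<in>UNIV. emeasure lborel (B i))"
proof -
  interpret finite_product_sigma_finite "\<lambda>_::'n. lborel :: 'a measure" UNIV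
    by standard auto
  have "vec_lambda -` {x. \<forall>i. x $ i \<in> B i} \<inter> space (PiM UNIV (\<lambda>_. lborel)) = PiE UNIV B"
    by (auto simp: space_PiM PiE_def Pi_def)
  then have "emeasure lborel {x. \<forall>i. x $ i \<in> B i} = emeasure (PiM UNIV (\<lambda>_. lborel)) (PiE UNIV B)"
    unfolding lborel_vec
    by (subst emeasure_distr[OF vec_lambda_measurable_PiM]) (simp_all only: borel_vec_box[OF assms])
  also have "\<dots> = (\<Prod>i\<in>UNIV. emeasure lborel (B i))"
    using assms by (intro measure_times) auto
  finally show ?thesis .
qed

lemma emeasure_sphere_measure_sgn:
  fixes B :: "'a::euclidean_space set"
  assumes "B \<in> sets sphere_measure"
  shows "emeasure sphere_measure B = of_nat DIM('a) * emeasure lborel ((ball 0 1 - {0}) \<inter> sgn -` B)"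
    "(ball 0 1 - {0}) \<inter> sgn -` B \<in> sets borel"
proof -
  have B: "B \<in> sets (restrict_space borel (sphere 0 1))"
    using assms by (simp add: sets_sphere_measure)
  have "sgn -` B \<inter> space (restrict_space lborel (ball 0 1 - {0 :: 'a}))
      \<in> sets (restrict_space lborel (ball 0 1 - {0 :: 'a}))"
    by (rule measurable_sets[OF sgn_measurable_sphere B])
  then have *: "(ball 0 1 - {0 :: 'a}) \<inter> sgn -` B \<in> sets (restrict_space lborel (ball 0 1 - {0 :: 'a}))"
    by (simp add: space_restrict_space Int_commute)
  then show "(ball 0 1 - {0}) \<inter> sgn -` B \<in> sets borel"
    by (auto simp: sets_restrict_space_iff)
  show "emeasure sphere_measure B = of_nat DIM('a) * emeasure lborel ((ball 0 1 - {0}) \<inter> sgn -` B)"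
    using * by (simp add: sphere_measure_def emeasure_distr[OF sgn_measurable_sphere B]
        space_restrict_space emeasure_restrict_space Int_commute)
qed

definition vsgn :: "'a::real_normed_vector ^ 'n \<Rightarrow> 'a ^ 'n" where
  "vsgn z = (\<chi> i. sgn (z $ i))"

text \<open>Each component is scaled independently. This turns nullity on the product of spheres
  into Lebesgue nullity in the ambient vector space, where Lipschitz images and starlike sets can be
  handled.\<close>

definition radial_cone :: "('a::real_normed_vector ^ 'n) set \<Rightarrow> ('a ^ 'n) set" where
  "radial_cone S = {z. (\<forall>i. z $ i \<noteq> 0) \<and> vsgn z \<in> S}"

definition punctured_balls :: "('a::real_normed_vector ^ 'n) set" where
  "punctured_balls = {z. \<forall>i. z $ i \<in> ball 0 1 - {0}}"

lemma punctured_balls_borel: "(punctured_balls :: ('a::euclidean_space ^ 'n::finite) set) \<in> sets borel"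
  unfolding punctured_balls_def by (rule borel_vec_box) simp

lemma sgn_components_measurable:
  "(\<lambda>z i. sgn (z $ i)) \<in> restrict_space lborel (punctured_balls :: (real ^ 'd ^ 'n) set)
     \<rightarrow>\<^sub>M PiM UNIV (\<lambda>_::'n::finite. sphere_measure)"
proof (rule measurable_PiM_single')
  fix i :: 'n
  have "(\<lambda>z :: real ^ 'd ^ 'n. z $ i) \<in> borel_measurable lborel"
    by (simp add: borel_measurable_continuous_onI continuous_on_component)
  then have "(\<lambda>z :: real ^ 'd ^ 'n. sgn (z $ i)) \<in> borel_measurable lborel" by simp
  then have "(\<lambda>z :: real ^ 'd ^ 'n. sgn (z $ i)) \<in> restrict_space lborel punctured_balls
      \<rightarrow>\<^sub>M restrict_space borel (sphere 0 1)"
    by (intro measurable_restrict_space2 measurable_restrict_space1)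
      (auto simp: space_restrict_space punctured_balls_def norm_sgn)
  then show "(\<lambda>z :: real ^ 'd ^ 'n. sgn (z $ i)) \<in> restrict_space lborel punctured_balls \<rightarrow>\<^sub>M sphere_measure"
    using measurable_cong_sets[OF refl sets_sphere_measure] by blast
qed (auto simp: space_restrict_space punctured_balls_def norm_sgn)

text \<open>A product of images is the image of the product, and every factor contributes one
  dimension constant. Checking rectangles suffices by uniqueness of the product measure.\<close>

lemma PiM_sphere_measure:
  "PiM UNIV (\<lambda>_::'n::finite. sphere_measure :: (real ^ 'd) measure) =
     scale_measure (of_nat CARD('d) ^ CARD('n))
       (distr (restrict_space lborel punctured_balls) (PiM UNIV (\<lambda>_. sphere_measure)) (\<lambda>z i. sgn (z $ i)))"
    (is "?M = scale_measure ?c ?D")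
proof (rule sym)
  interpret product_sigma_finite "\<lambda>_::'n. sphere_measure :: (real ^ 'd) measure"
    using finite_measure_sphere_measure
    by (auto simp: product_sigma_finite_def finite_measure_def)
  show "scale_measure ?c ?D = ?M"
  proof (rule PiM_eqI)
    fix A :: "'n \<Rightarrow> (real ^ 'd) set" assume A: "\<And>i. i \<in> UNIV \<Longrightarrow> A i \<in> sets sphere_measure"
    let ?B = "\<lambda>i. (ball 0 1 - {0}) \<inter> sgn -` A i"
    have "PiE UNIV A \<in> sets ?M"
      using A by (intro sets_PiM_I_finite) auto
    then have "emeasure (scale_measure ?c ?D) (PiE UNIV A) = ?c * emeasure (restrict_space lborel punctured_balls)
      ((\<lambda>z i. sgn (z $ i)) -` PiE UNIV A \<inter> (punctured_balls :: (real ^ 'd ^ 'n) set))"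
      by (simp add: emeasure_distr[OF sgn_components_measurable] space_restrict_space)
    also have "(\<lambda>z i. sgn (z $ i)) -` PiE UNIV A \<inter> punctured_balls = {z. \<forall>i. z $ i \<in> ?B i}"
      by (auto simp: punctured_balls_def)
    also have "emeasure (restrict_space lborel punctured_balls) {z. \<forall>i. z $ i \<in> ?B i}
        = emeasure lborel {z. \<forall>i. z $ i \<in> ?B i}"
      using punctured_balls_borel by (intro emeasure_restrict_space) (auto simp: punctured_balls_def)
    also have "\<dots> = (\<Prod>i\<in>UNIV. emeasure lborel (?B i))"
      using A by (intro emeasure_lborel_vec_box emeasure_sphere_measure_sgn(2)) auto
    also have "?c * \<dots> = (\<Prod>i\<in>UNIV. emeasure sphere_measure (A i))"
      using A by (simp add: emeasure_sphere_measure_sgn(1) prod.distrib)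
    finally show "emeasure (scale_measure ?c ?D) (PiE UNIV A) = (\<Prod>i\<in>UNIV. emeasure sphere_measure (A i))" .
  qed auto
qed

lemma null_sets_sphere_product_measure:
  fixes S :: "(real ^ 'd ^ 'n) set"
  assumes S: "S \<in> sets borel" "S \<subseteq> sphere_product" and neg: "negligible (radial_cone S)"
  shows "S \<in> null_sets sphere_product_measure"
proof -
  let ?M = "PiM UNIV (\<lambda>_::'n::finite. sphere_measure :: (real ^ 'd) measure)"
  let ?Z = "(\<lambda>z i. sgn (z $ i)) -` (vec_lambda -` S \<inter> space ?M) \<inter> (punctured_balls :: (real ^ 'd ^ 'n) set)"
  have S': "S \<in> sets (restrict_space borel sphere_product)"
    using S by (auto simp: sets_restrict_space)
  have V: "vec_lambda -` S \<inter> space ?M \<in> sets ?M"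
    by (rule measurable_sets[OF vec_lambda_measurable_sphere_product S'])
  have "?Z \<in> sets (restrict_space lborel punctured_balls)"
    using measurable_sets[OF sgn_components_measurable V] unfolding space_restrict_space by simp
  moreover have "(punctured_balls :: (real ^ 'd ^ 'n) set) \<inter> space lborel \<in> sets lborel"
    using punctured_balls_borel by simp
  ultimately have "?Z \<in> sets lborel"
    by (rule sets_restrict_space_iff[THEN iffD1, THEN conjunct2, rotated])
  then have Z: "?Z \<in> sets borel" unfolding sets_lborel .
  have "?Z \<subseteq> radial_cone S"
    by (auto simp: radial_cone_def punctured_balls_def vsgn_def)
  then have "negligible ?Z" using neg negligible_subset by blast
  then have Z0: "emeasure lborel ?Z = 0"
    unfolding negligible_iff_null_sets using Z
    by (metis null_setsD1 null_sets_completion_iff sets_lborel)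
  have "emeasure sphere_product_measure S = emeasure ?M (vec_lambda -` S \<inter> space ?M)"
    by (simp add: sphere_product_measure_def emeasure_distr[OF vec_lambda_measurable_sphere_product S'])
  also have "\<dots> = of_nat CARD('d) ^ CARD('n) * emeasure (restrict_space lborel punctured_balls) ?Z"
    by (subst PiM_sphere_measure)
      (simp add: emeasure_distr[OF sgn_components_measurable V] space_restrict_space)
  also have "emeasure (restrict_space lborel punctured_balls) ?Z = emeasure lborel ?Z"
    using punctured_balls_borel by (intro emeasure_restrict_space) auto
  finally show ?thesis
    using Z0 S' by (intro null_setsI) (simp_all add: sphere_product_measure_def)
qed

subsection \<open>The consensus map and its inverse\<close>

lemma norm_vec_le:
  assumes "0 \<le> c" "\<And>i. norm (x $ i) \<le> c * norm (y $ i)"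
  shows "norm (x :: 'a::real_normed_vector ^ 'n::finite) \<le> c * norm (y :: 'a ^ 'n)"
proof -
  have "norm x \<le> L2_set (\<lambda>i. c * norm (y $ i)) UNIV"
    unfolding norm_vec_def using assms by (intro L2_set_mono) auto
  then show ?thesis using assms(1) by (simp add: norm_vec_def L2_set_right_distrib)
qed

lemma norm_vec_le_sum: "norm (x :: 'a::real_normed_vector ^ 'n::finite) \<le> (\<Sum>i\<in>UNIV. norm (x $ i))"
  unfolding norm_vec_def by (intro L2_set_le_sum) simp

lemma norm_vec_le_card:
  assumes "\<And>i. norm (x $ i) \<le> c"
  shows "norm (x :: 'a::real_normed_vector ^ 'n::finite) \<le> real CARD('n) * c"
  using norm_vec_le_sum[of x] sum_mono[of UNIV "\<lambda>i. norm (x $ i)" "\<lambda>_. c"] assms by simp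

lemma norm_sgn_diff_le:
  fixes x y :: "'a::real_normed_vector"
  assumes "x \<noteq> 0"
  shows "norm (sgn y - sgn x) \<le> 2 / norm x * norm (y - x)"
proof -
  have "norm x *\<^sub>R (sgn y - sgn x) = (norm x - norm y) *\<^sub>R sgn y + (y - x)"
    using assms by (cases "y = 0") (simp_all add: algebra_simps sgn_div_norm)
  then have "norm x * norm (sgn y - sgn x) = norm ((norm x - norm y) *\<^sub>R sgn y + (y - x))"
    by (metis norm_scaleR abs_norm_cancel)
  also have "\<dots> \<le> \<bar>norm x - norm y\<bar> * norm (sgn y) + norm (y - x)"
    using norm_triangle_ineq by (metis norm_scaleR)
  also have "\<bar>norm x - norm y\<bar> * norm (sgn y) \<le> norm (y - x) * 1"
    using norm_triangle_ineq3[of x y]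
    by (intro mult_mono) (auto simp: norm_sgn norm_minus_commute)
  finally show ?thesis using assms by (simp add: field_simps)
qed

lemma vsgn_component [simp]: "vsgn z $ i = sgn (z $ i)"
  by (simp add: vsgn_def)

lemma sphere_productI: "(\<And>i. norm (x $ i) = 1) \<Longrightarrow> x \<in> sphere_product"
  by (simp add: sphere_product_def)

lemma sphere_productD: "x \<in> sphere_product \<Longrightarrow> norm (x $ i) = 1"
  by (simp add: sphere_product_def)

lemma compact_sphere_product: "compact (sphere_product :: (real ^ 'd ^ 'n) set)"
proof (rule compact_eq_bounded_closed[THEN iffD2], rule conjI)
  show "bounded (sphere_product :: (real ^ 'd ^ 'n) set)"
    by (rule boundedI[of _ "real CARD('n) * 1"]) (intro norm_vec_le_card, simp add: sphere_productD)
  have eq: "sphere_product = (\<Inter>i. {x :: real ^ 'd ^ 'n. norm (x $ i) = 1})"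
    by (auto simp: sphere_product_def)
  show "closed (sphere_product :: (real ^ 'd ^ 'n) set)"
    unfolding eq by (intro closed_INT ballI closed_Collect_eq continuous_intros)
qed

text \<open>Positive rational factors, one per component, move any point of the cone into the shell.
  There are countably many such scalings, and the linear maps undoing them preserve null
  sets.\<close>

lemma negligible_radial_cone_shell:
  fixes S :: "('a::euclidean_space ^ 'n::finite) set"
  assumes "0 < \<delta>" and neg: "negligible (radial_cone S \<inter> {z. \<forall>i. norm (z $ i) \<in> {1 - \<delta>..1 + \<delta>}})"
  shows "negligible (radial_cone S)"
proof -
  let ?Z = "radial_cone S \<inter> {z. \<forall>i. norm (z $ i) \<in> {1 - \<delta>..1 + \<delta>}}"
  define scale where "scale q z = (\<chi> i. z $ i /\<^sub>R of_rat (q i))" for q :: "'n \<Rightarrow> rat" and z :: "'a ^ 'n"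
  have lin: "linear (scale q)" for q
    by (rule linearI) (simp_all add: scale_def vec_eq_iff scaleR_right_distrib)
  have "negligible (\<Union>q. scale q ` ?Z)"
  proof (intro negligible_countable_Union countable_image countableI_type)
    fix T assume "T \<in> range (\<lambda>q. scale q ` ?Z)"
    then obtain q where T: "T = scale q ` ?Z" by blast
    have "scale q differentiable_on ?Z"
      using lin linear_conv_bounded_linear bounded_linear_imp_differentiable_on by blast
    then show "negligible T"
      unfolding T by (intro negligible_differentiable_image_negligible neg order_refl)
  qed
  moreover have "radial_cone S \<subseteq> (\<Union>q. scale q ` ?Z)"
  proof
    fix z assume z: "z \<in> radial_cone S"
    then have nz: "\<And>i. 0 < norm (z $ i)" by (simp add: radial_cone_def)
    \<comment> \<open>The maximum with 0 keeps the rational positive even if \<delta> exceeds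
      1.\<close>
    have "\<exists>q. max 0 (1 - \<delta>) / norm (z $ i) < of_rat q \<and> of_rat q < (1 + \<delta>) / norm (z $ i)" for i
      using nz[of i] assms(1) by (intro of_rat_dense divide_strict_right_mono) auto
    then obtain q where q: "\<And>i. max 0 (1 - \<delta>) / norm (z $ i) < of_rat (q i)"
        "\<And>i. of_rat (q i) < (1 + \<delta>) / norm (z $ i)"
      by metis
    have pos: "0 < (of_rat (q i) :: real)" for i
      using q(1)[of i] nz[of i] by (meson divide_nonneg_pos le_less_trans max.cobounded1)
    define y where "y = (\<chi> i. of_rat (q i) *\<^sub>R z $ i)"
    have "vsgn y = vsgn z"
      using pos by (simp add: vsgn_def y_def vec_eq_iff sgn_scaleR)
    moreover have "norm (y $ i) \<in> {1 - \<delta>..1 + \<delta>}" for i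
      using q[of i] nz[of i] pos[of i] by (auto simp: y_def pos_less_divide_eq pos_divide_less_eq)
    moreover have "y $ i \<noteq> 0" for i
      using pos[of i] nz[of i] by (simp add: y_def)
    ultimately have "y \<in> ?Z" using z by (simp add: radial_cone_def)
    moreover have "z = scale q y"
      using pos by (simp add: scale_def y_def vec_eq_iff less_imp_neq[THEN not_sym])
    ultimately show "z \<in> (\<Union>q. scale q ` ?Z)" by blast
  qed
  ultimately show ?thesis by (rule negligible_subset)
qed

definition mix :: "real ^ 'n ^ 'n \<Rightarrow> real ^ 'd ^ 'n \<Rightarrow> real ^ 'd ^ 'n" where
  "mix A x = (\<chi> i. \<Sum>j\<in>UNIV. A $ i $ j *\<^sub>R x $ j)"

lemma mix_component: "mix A x $ i = (\<Sum>j\<in>UNIV. A $ i $ j *\<^sub>R x $ j)"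
  by (simp add: mix_def)

lemma linear_mix: "linear (mix A)"
  by (rule linearI)
    (simp_all add: mix_def vec_eq_iff scaleR_right_distrib sum.distrib scaleR_sum_right mult.commute)

lemma consensus_map_eq: "consensus_map A x = vsgn (mix A x)"
  by (simp add: consensus_map_def vsgn_def mix_def sgn_div_norm)

locale dominant_matrix =
  fixes A :: "real ^ 'n::finite ^ 'n"
  assumes entries_nonneg: "0 \<le> A $ i $ j"
    and symmetric: "A $ i $ j = A $ j $ i"
    and dominant: "sqrt 2 * (\<Sum>j\<in>UNIV - {i}. A $ i $ j) < A $ i $ i"
begin

definition radius :: "'n \<Rightarrow> real" where
  "radius i = (\<Sum>j\<in>UNIV - {i}. A $ i $ j)"

definition off_diagonal :: "real ^ 'd ^ 'n \<Rightarrow> 'n \<Rightarrow> real ^ 'd" where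
  "off_diagonal x i = (\<Sum>j\<in>UNIV - {i}. A $ i $ j *\<^sub>R x $ j)"

lemma radius_nonneg: "0 \<le> radius i"
  by (simp add: radius_def sum_nonneg entries_nonneg)

lemma radius_less: "radius i < A $ i $ i"
proof -
  have "1 * radius i \<le> sqrt 2 * radius i" using radius_nonneg by (intro mult_right_mono) auto
  then show ?thesis using dominant[of i] by (simp add: radius_def)
qed

lemma diagonal_pos: "0 < A $ i $ i"
  using radius_nonneg radius_less le_less_trans by blast

lemma mix_split: "mix A x $ i = A $ i $ i *\<^sub>R x $ i + off_diagonal x i"
  by (simp add: mix_def off_diagonal_def sum.remove[of UNIV i])

lemma norm_off_diagonal_diff_le:
  assumes "\<And>j. norm (x $ j - y $ j) \<le> c"
  shows "norm (off_diagonal x i - off_diagonal y i) \<le> radius i * c"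
proof -
  have "off_diagonal x i - off_diagonal y i = (\<Sum>j\<in>UNIV - {i}. A $ i $ j *\<^sub>R (x $ j - y $ j))"
    by (simp add: off_diagonal_def sum_subtractf scaleR_diff_right)
  also have "norm \<dots> \<le> (\<Sum>j\<in>UNIV - {i}. A $ i $ j * c)"
    using assms entries_nonneg by (intro sum_norm_le) (simp add: mult_left_mono)
  finally show ?thesis by (simp add: radius_def sum_distrib_right)
qed

lemma norm_off_diagonal_le: "x \<in> sphere_product \<Longrightarrow> norm (off_diagonal x i) \<le> radius i"
  using norm_off_diagonal_diff_le[of x 0 1 i] by (simp add: sphere_productD off_diagonal_def)

lemma mix_nonzero:
  assumes "x \<in> sphere_product"
  shows "mix A x $ i \<noteq> 0"
proof
  assume "mix A x $ i = 0"
  then have "A $ i $ i *\<^sub>R x $ i = - off_diagonal x i"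
    by (simp add: mix_split eq_neg_iff_add_eq_0)
  then have "norm (A $ i $ i *\<^sub>R x $ i) = norm (off_diagonal x i)" by simp
  then show False
    using norm_off_diagonal_le[OF assms, of i] radius_less[of i] diagonal_pos[of i] assms
    by (simp add: sphere_productD)
qed

lemma consensus_map_sphere_product: "x \<in> sphere_product \<Longrightarrow> consensus_map A x \<in> sphere_product"
  by (intro sphere_productI) (simp add: consensus_map_eq norm_sgn mix_nonzero)

lemma iterate_sphere_product: "x \<in> sphere_product \<Longrightarrow> (consensus_map A ^^ k) x \<in> sphere_product"
  by (induction k) (auto intro: consensus_map_sphere_product)

lemma continuous_on_iterate:
  "continuous_on (sphere_product :: (real ^ 'd ^ 'n) set) (consensus_map A ^^ k)"
proof (induction k)
  case (Suc k)
  have "continuous_on sphere_product (consensus_map A :: real ^ 'd ^ 'n \<Rightarrow> _)"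
    unfolding consensus_map_eq vsgn_def sgn_div_norm
    by (intro continuous_intros linear_continuous_on linear_conv_bounded_linear[THEN iffD1] linear_mix)
      (simp_all add: mix_nonzero)
  then have "continuous_on sphere_product (consensus_map A \<circ> (consensus_map A ^^ k) :: real ^ 'd ^ 'n \<Rightarrow> _)"
    by (intro continuous_on_compose Suc)
      (auto intro: continuous_on_subset iterate_sphere_product)
  then show ?case by simp
qed (simp add: id_def)

text \<open>
  In the maximum norm, \<open>x\<close> is recovered from \<open>f x\<close> as the fixed point of a contraction, by
  \<open>sphere_preimage_Lipschitz\<close> applied to each component.
\<close>

lemma consensus_map_inverse_Lipschitz:
  obtains C where "0 \<le> C" "\<And>x y :: real ^ 'd ^ 'n. \<lbrakk>x \<in> sphere_product; y \<in> sphere_product\<rbrakk>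
      \<Longrightarrow> norm (x - y) \<le> C * norm (consensus_map A x - consensus_map A y)"
proof -
  define t where "t i = sqrt 2 / A $ i $ i * radius i" for i
  define q where "q = Max (range t)"
  have "t i < 1" for i
    using dominant[of i] diagonal_pos[of i] by (simp add: t_def radius_def)
  then have q1: "q < 1" by (simp add: q_def)
  have tq: "t i \<le> q" for i by (simp add: q_def)
  show thesis
  proof (rule that)
    fix x y :: "real ^ 'd ^ 'n" assume xy: "x \<in> sphere_product" "y \<in> sphere_product"
    define D where "D = Max (range (\<lambda>i. norm (x $ i - y $ i)))"
    define e where "e = norm (consensus_map A x - consensus_map A y)"
    have D: "norm (x $ i - y $ i) \<le> D" for i by (simp add: D_def)
    have D0: "0 \<le> D" using D norm_ge_zero order_trans by blast
    have "D \<in> range (\<lambda>i. norm (x $ i - y $ i))" unfolding D_def by (intro Max_in) auto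
    \<comment> \<open>At a component attaining the maximum, the estimate returns \<open>D\<close> on
      the right with factor \<open>q < 1\<close>, so it can be absorbed.\<close>
    then obtain i where i: "D = norm (x $ i - y $ i)" by blast
    have "D \<le> sqrt 2 / A $ i $ i * norm (off_diagonal x i - off_diagonal y i)
        + 5 * norm (consensus_map A x $ i - consensus_map A y $ i)"
      unfolding i consensus_map_eq vsgn_component mix_split
      using dominant[of i] xy
      by (intro sphere_preimage_Lipschitz[of _ _ _ "radius i"] norm_off_diagonal_le)
        (auto simp: sphere_productD radius_def)
    also have "\<dots> \<le> sqrt 2 / A $ i $ i * (radius i * D) + 5 * e"
      using norm_off_diagonal_diff_le[of x y D i] D diagonal_pos[of i]
        Finite_Cartesian_Product.norm_nth_le[of "consensus_map A x - consensus_map A y" i]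
      by (intro add_mono mult_left_mono) (auto simp: e_def)
    also have "\<dots> = t i * D + 5 * e" by (simp add: t_def)
    also have "\<dots> \<le> q * D + 5 * e" using tq D0 by (simp add: mult_right_mono)
    finally have "(1 - q) * D \<le> 5 * e" by (simp add: algebra_simps)
    then have "D \<le> 5 / (1 - q) * e" using q1 by (simp add: field_simps)
    then have "real CARD('n) * D \<le> real CARD('n) * (5 / (1 - q)) * e"
      using mult_left_mono[of D _ "real CARD('n)"] by (simp only: mult.assoc)
    moreover have "norm (x - y) \<le> real CARD('n) * D" using D by (intro norm_vec_le_card) simp
    ultimately show "norm (x - y) \<le> real CARD('n) * (5 / (1 - q)) * e" by simp
  qed (use q1 in simp)
qed

text \<open>The Lipschitz inverse of the map is extended to the cones so that it preserves the norm
  of each component. The extension is locally Lipschitz, so it sends the null cone over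
  \<open>W\<close> to a null set containing the cone over the preimage.\<close>

lemma negligible_preimage:
  fixes W :: "(real ^ 'd ^ 'n) set"
  assumes "negligible (radial_cone W)"
  shows "negligible (radial_cone {x \<in> sphere_product. consensus_map A x \<in> W})"
proof -
  obtain C where C: "0 \<le> C" "\<And>x y :: real ^ 'd ^ 'n. \<lbrakk>x \<in> sphere_product; y \<in> sphere_product\<rbrakk>
      \<Longrightarrow> norm (x - y) \<le> C * norm (consensus_map A x - consensus_map A y)"
    using consensus_map_inverse_Lipschitz by blast
  have inj: "inj_on (consensus_map A) (sphere_product :: (real ^ 'd ^ 'n) set)"
    using C(2) by (fastforce intro: inj_onI)
  define h where "h = inv_into (sphere_product :: (real ^ 'd ^ 'n) set) (consensus_map A)"
  define H where "H y = (\<chi> i. norm (y $ i) *\<^sub>R h (vsgn y) $ i)" for y :: "real ^ 'd ^ 'n"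
  \<comment> \<open>The inverse \<open>h\<close> is controlled only on the image of the map, so the
    cone is cut down to it.\<close>
  define T where "T = radial_cone (W \<inter> consensus_map A ` sphere_product)"
  have hT: "h (vsgn y) \<in> sphere_product" "consensus_map A (h (vsgn y)) = vsgn y" if "y \<in> T" for y
    using that by (auto simp: T_def radial_cone_def h_def inv_into_into f_inv_into_f)
  have "negligible (H ` T)"
  proof (rule negligible_locally_Lipschitz_image)
    have "T \<subseteq> radial_cone W" by (auto simp: T_def radial_cone_def)
    then show "negligible T" using assms negligible_subset by blast
    fix x assume x: "x \<in> T"
    \<comment> \<open>\<open>K\<close> bounds the variation of \<open>vsgn\<close> from
      \<open>x\<close>. It blows up as components of \<open>x\<close> approach 0, so the Lipschitz
      constant must depend on \<open>x\<close>.\<close>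
    define K where "K = (\<Sum>i\<in>UNIV. 2 / norm (x $ i))"
    have "norm (H y - H x) \<le> real CARD('n) * (1 + norm x * (C * K)) * norm (y - x)" if y: "y \<in> T" for y
    proof -
      have "norm (vsgn y - vsgn x) \<le> (\<Sum>i\<in>UNIV. norm ((vsgn y - vsgn x) $ i))"
        by (rule norm_vec_le_sum)
      also have "\<dots> \<le> (\<Sum>i\<in>UNIV. 2 / norm (x $ i) * norm (y - x))"
      proof (rule sum_mono)
        fix i
        have "norm ((vsgn y - vsgn x) $ i) \<le> 2 / norm (x $ i) * norm (y $ i - x $ i)"
          using x norm_sgn_diff_le[of "x $ i" "y $ i"] by (simp add: T_def radial_cone_def)
        also have "\<dots> \<le> 2 / norm (x $ i) * norm (y - x)"
          using Finite_Cartesian_Product.norm_nth_le[of "y - x" i] by (intro mult_left_mono) auto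
        finally show "norm ((vsgn y - vsgn x) $ i) \<le> 2 / norm (x $ i) * norm (y - x)" .
      qed
      finally have vs: "norm (vsgn y - vsgn x) \<le> K * norm (y - x)"
        by (simp add: K_def sum_distrib_right)
      have hh: "norm (h (vsgn y) - h (vsgn x)) \<le> C * K * norm (y - x)"
        using C(2)[OF hT(1)[OF y] hT(1)[OF x]] hT(2)[OF x] hT(2)[OF y] C(1)
        using mult_left_mono[OF vs C(1)] by (simp add: mult.assoc)
      have "norm ((H y - H x) $ i) \<le> (1 + norm x * (C * K)) * norm (y - x)" for i
      proof -
        have "(H y - H x) $ i = (norm (y $ i) - norm (x $ i)) *\<^sub>R h (vsgn y) $ i
            + norm (x $ i) *\<^sub>R (h (vsgn y) - h (vsgn x)) $ i"
          by (simp add: H_def algebra_simps)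
        also have "norm \<dots> \<le> norm (y - x) + norm x * (C * K * norm (y - x))"
        proof (intro norm_triangle_le add_mono)
          have "\<bar>norm (y $ i) - norm (x $ i)\<bar> \<le> norm (y - x)"
            using norm_triangle_ineq3[of "y $ i" "x $ i"] Finite_Cartesian_Product.norm_nth_le[of "y - x" i] by simp
          then show "norm ((norm (y $ i) - norm (x $ i)) *\<^sub>R h (vsgn y) $ i) \<le> norm (y - x)"
            using hT(1)[OF y] by (simp add: sphere_productD)
          show "norm (norm (x $ i) *\<^sub>R (h (vsgn y) - h (vsgn x)) $ i) \<le> norm x * (C * K * norm (y - x))"
            unfolding norm_scaleR abs_norm_cancel
            using order_trans[OF Finite_Cartesian_Product.norm_nth_le[of "h (vsgn y) - h (vsgn x)" i] hh]
            by (intro mult_mono Finite_Cartesian_Product.norm_nth_le) auto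
        qed
        finally show ?thesis by (simp add: algebra_simps)
      qed
      then have "norm (H y - H x) \<le> real CARD('n) * ((1 + norm x * (C * K)) * norm (y - x))"
        by (rule norm_vec_le_card)
      then show ?thesis by (simp add: mult.assoc)
    qed
    then show "\<exists>U B. open U \<and> x \<in> U \<and> (\<forall>y\<in>T \<inter> U. norm (H y - H x) \<le> B * norm (y - x))"
      by (intro exI[of _ UNIV]) auto
  qed simp
  moreover have "radial_cone {x \<in> sphere_product. consensus_map A x \<in> W} \<subseteq> H ` T"
  proof
    fix z assume "z \<in> radial_cone {x \<in> sphere_product. consensus_map A x \<in> W}"
    then have nz: "\<And>i. z $ i \<noteq> 0" and z: "vsgn z \<in> sphere_product" "consensus_map A (vsgn z) \<in> W"
      by (auto simp: radial_cone_def)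
    \<comment> \<open>\<open>y\<close> has the directions of the image of \<open>vsgn z\<close> and
      the component norms of \<open>z\<close>, so \<open>H\<close> carries it back to
      \<open>z\<close>.\<close>
    define y where "y = (\<chi> i. norm (z $ i) *\<^sub>R consensus_map A (vsgn z) $ i)"
    have n1: "norm (consensus_map A (vsgn z) $ i) = 1" for i
      using consensus_map_sphere_product[OF z(1)] by (rule sphere_productD)
    have "sgn (consensus_map A (vsgn z) $ i) = consensus_map A (vsgn z) $ i" for i
      using n1[of i] by (simp add: sgn_div_norm)
    then have y: "vsgn y = consensus_map A (vsgn z)" "\<And>i. norm (y $ i) = norm (z $ i)"
      using nz n1 by (simp_all add: y_def vec_eq_iff sgn_scaleR)
    then have "y $ i \<noteq> 0" for i using nz by (metis norm_eq_zero)
    then have "y \<in> T" using y(1) z by (auto simp: T_def radial_cone_def)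
    moreover have "H y = z"
      using nz inj z(1) by (simp add: H_def y h_def inv_into_f_f vec_eq_iff sgn_div_norm)
    ultimately show "z \<in> H ` T" by blast
  qed
  ultimately show ?thesis by (rule negligible_subset)
qed

lemma negligible_iterated_preimage:
  fixes W :: "(real ^ 'd ^ 'n) set"
  assumes "negligible (radial_cone W)"
  shows "negligible (radial_cone {x \<in> sphere_product. (consensus_map A ^^ k) x \<in> W})"
proof (induction k)
  case 0
  have "radial_cone {x \<in> sphere_product. (consensus_map A ^^ 0) x \<in> W} \<subseteq> radial_cone W"
    by (auto simp: radial_cone_def)
  then show ?case using assms negligible_subset by blast
next
  case (Suc k)
  have "{x \<in> sphere_product. (consensus_map A ^^ Suc k) x \<in> W}
      = {x \<in> sphere_product. consensus_map A x \<in> {x \<in> sphere_product. (consensus_map A ^^ k) x \<in> W}}"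
    by (auto simp del: funpow.simps simp: funpow_Suc_right consensus_map_sphere_product)
  then show ?case using negligible_preimage[OF Suc] by simp
qed

end

subsection \<open>Instability outside the consensus set\<close>

text \<open>At \<open>x\<close> in \<open>sphere_product\<close> this is the orthogonal projection
  onto the tangent space of the product of spheres, so \<open>vsgn_deriv x e = e\<close> says that
  \<open>e\<close> is tangent.\<close>

definition vsgn_deriv :: "'a::real_inner ^ 'n \<Rightarrow> 'a ^ 'n \<Rightarrow> 'a ^ 'n" where
  "vsgn_deriv p v = (\<chi> i. sgn_deriv (p $ i) (v $ i))"

lemma linear_vsgn_deriv: "linear (vsgn_deriv p)"
  by (rule linearI)
    (simp_all add: vsgn_deriv_def sgn_deriv_def vec_eq_iff algebra_simps inner_simps)

lemma vsgn_strictly_differentiable: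
  fixes p0 :: "'a::real_inner ^ 'n::finite"
  assumes "\<And>i. p0 $ i \<noteq> 0" "0 < \<epsilon>"
  obtains \<delta> where "0 < \<delta>" "\<And>p q. \<lbrakk>norm (p - p0) < \<delta>; norm (q - p0) < \<delta>\<rbrakk>
    \<Longrightarrow> norm (vsgn p - vsgn q - vsgn_deriv p0 (p - q)) \<le> \<epsilon> * norm (p - q)"
proof -
  have "\<exists>\<delta>>0. \<forall>p q. norm (p - p0 $ i) < \<delta> \<longrightarrow> norm (q - p0 $ i) < \<delta>
      \<longrightarrow> norm (sgn p - sgn q - sgn_deriv (p0 $ i) (p - q)) \<le> \<epsilon> * norm (p - q)" for i
    by (rule sgn_strictly_differentiable[OF assms(1)[of i] assms(2)]) blast
  then obtain D where D: "\<And>i. 0 < D i" "\<And>i p q. norm (p - p0 $ i) < D i \<Longrightarrow> norm (q - p0 $ i) < D i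
      \<Longrightarrow> norm (sgn p - sgn q - sgn_deriv (p0 $ i) (p - q)) \<le> \<epsilon> * norm (p - q)"
    by metis
  show thesis
  proof (rule that)
    show "0 < Min (range D)" using D(1) by simp
    fix p q assume pq: "norm (p - p0) < Min (range D)" "norm (q - p0) < Min (range D)"
    have le: "norm (p $ i - p0 $ i) < D i" if "norm (p - p0) < Min (range D)" for p i
    proof -
      have "norm (p $ i - p0 $ i) \<le> norm (p - p0)"
        using Finite_Cartesian_Product.norm_nth_le[of "p - p0" i] by simp
      also note that
      also have "Min (range D) \<le> D i" by simp
      finally show ?thesis .
    qed
    show "norm (vsgn p - vsgn q - vsgn_deriv p0 (p - q)) \<le> \<epsilon> * norm (p - q)"
    proof (rule norm_vec_le)
      fix i
      show "norm ((vsgn p - vsgn q - vsgn_deriv p0 (p - q)) $ i) \<le> \<epsilon> * norm ((p - q) $ i)"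
        using D(2)[of "p $ i" i "q $ i"] le pq by (simp add: vsgn_deriv_def)
    qed (use assms(2) in simp)
  qed
qed

lemma vsgn_deriv_sphere_product:
  assumes "x \<in> sphere_product"
  shows "vsgn_deriv x v $ i = v $ i - (v $ i \<bullet> x $ i) *\<^sub>R x $ i"
  using sphere_productD[OF assms, of i] by (simp add: vsgn_deriv_def sgn_deriv_def sgn_div_norm)

lemma norm_vsgn_deriv_le:
  assumes "x \<in> sphere_product"
  shows "norm (vsgn_deriv x v) \<le> norm v"
proof -
  have "norm (vsgn_deriv x v) \<le> 1 * norm v"
    by (rule norm_vec_le)
      (simp_all add: vsgn_deriv_sphere_product[OF assms] norm_orthogonal_part_le(1)[OF sphere_productD[OF assms]])
  then show ?thesis by simp
qed

lemma vsgn_deriv_selfadjoint: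
  assumes "x \<in> sphere_product"
  shows "vsgn_deriv x u $ i \<bullet> v $ i = u $ i \<bullet> vsgn_deriv x v $ i"
  by (simp add: vsgn_deriv_sphere_product[OF assms] inner_simps inner_commute)

text \<open>The estimate rests on \<open>(y\<^sub>i - y'\<^sub>i) \<bullet> (y\<^sub>i + y'\<^sub>i) = 0\<close> for unit vectors.\<close>

lemma norm_chord_normal_part_le:
  assumes x: "x \<in> sphere_product" and y: "y \<in> sphere_product" "y' \<in> sphere_product"
    and r: "norm (y - x) \<le> r" "norm (y' - x) \<le> r"
  shows "norm ((y - y') - vsgn_deriv x (y - y')) \<le> r * norm (y - y')"
proof (rule norm_vec_le)
  show "0 \<le> r" using r(1) norm_ge_zero order_trans by blast
  fix i
  let ?v = "y $ i - y' $ i"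
  have yi: "norm (y $ i - x $ i) \<le> r" "norm (y' $ i - x $ i) \<le> r"
    using r Finite_Cartesian_Product.norm_nth_le[of "y - x" i]
      Finite_Cartesian_Product.norm_nth_le[of "y' - x" i] by auto
  have "y $ i \<bullet> y $ i = 1" "y' $ i \<bullet> y' $ i = 1"
    using y by (simp_all add: sphere_productD flip: norm_eq_1)
  then have "2 * (?v \<bullet> x $ i) = - (?v \<bullet> (y $ i - x $ i) + ?v \<bullet> (y' $ i - x $ i))"
    by (simp add: inner_diff_left inner_diff_right inner_commute)
  then have "2 * (?v \<bullet> x $ i) = - (?v \<bullet> ((y $ i - x $ i) + (y' $ i - x $ i)))"
    by (simp only: inner_add_right)
  then have "2 * \<bar>?v \<bullet> x $ i\<bar> = \<bar>?v \<bullet> ((y $ i - x $ i) + (y' $ i - x $ i))\<bar>" by linarith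
  also have "\<dots> \<le> norm ?v * norm ((y $ i - x $ i) + (y' $ i - x $ i))"
    by (rule Cauchy_Schwarz_ineq2)
  also have "\<dots> \<le> norm ?v * (r + r)"
    using yi by (intro mult_left_mono norm_triangle_le add_mono) auto
  finally have "\<bar>?v \<bullet> x $ i\<bar> \<le> r * norm ?v" by (simp add: mult.commute)
  then show "norm ((y - y' - vsgn_deriv x (y - y')) $ i) \<le> r * norm ((y - y') $ i)"
    by (simp add: vsgn_deriv_sphere_product[OF x] sphere_productD[OF x])
qed

context dominant_matrix
begin

lemma mix_selfadjoint: "(\<Sum>i\<in>UNIV. mix A u $ i \<bullet> v $ i) = (\<Sum>i\<in>UNIV. u $ i \<bullet> mix A v $ i)"
proof -
  have "(\<Sum>i\<in>UNIV. mix A u $ i \<bullet> v $ i) = (\<Sum>i\<in>UNIV. \<Sum>j\<in>UNIV. A $ i $ j * (u $ j \<bullet> v $ i))"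
    by (simp add: mix_component inner_sum_left)
  also have "\<dots> = (\<Sum>j\<in>UNIV. \<Sum>i\<in>UNIV. A $ i $ j * (u $ j \<bullet> v $ i))"
    by (rule sum.swap)
  also have "\<dots> = (\<Sum>j\<in>UNIV. u $ j \<bullet> mix A v $ j)"
    by (simp add: mix_component inner_sum_right symmetric)
  finally show ?thesis .
qed

text \<open>Expand the nonnegative sum of \<open>B i j\<close> times the squared norm of
  \<open>v $ i + v $ j\<close>, where \<open>B\<close> is the off-diagonal part of \<open>A\<close>.
  By symmetry, row and column sums both equal \<open>radius\<close>, which the diagonal
  dominates.\<close>

lemma mix_nonneg: "0 \<le> (\<Sum>i\<in>UNIV. mix A v $ i \<bullet> v $ i)"
proof -
  define B where "B i j = (if i = j then 0 else A $ i $ j)" for i j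
  have B: "0 \<le> B i j" "B i j = B j i" for i j
    using entries_nonneg symmetric by (auto simp: B_def)
  have rad: "(\<Sum>j\<in>UNIV. B i j) = radius i" for i
  proof -
    have "(\<Sum>j\<in>UNIV. B i j) = (\<Sum>j\<in>UNIV - {i}. B i j)"
      by (simp add: sum.remove[of UNIV i] B_def)
    also have "\<dots> = radius i"
      unfolding radius_def by (intro sum.cong) (auto simp: B_def)
    finally show ?thesis .
  qed
  have sq: "(\<Sum>i\<in>UNIV. \<Sum>j\<in>UNIV. B i j * (v $ i \<bullet> v $ i)) = (\<Sum>i\<in>UNIV. radius i * (v $ i \<bullet> v $ i))"
    by (simp add: rad flip: sum_distrib_right)
  have "(\<Sum>i\<in>UNIV. \<Sum>j\<in>UNIV. B i j * (v $ j \<bullet> v $ j)) = (\<Sum>j\<in>UNIV. \<Sum>i\<in>UNIV. B i j * (v $ j \<bullet> v $ j))"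
    by (rule sum.swap)
  also have "\<dots> = (\<Sum>i\<in>UNIV. radius i * (v $ i \<bullet> v $ i))"
    unfolding sq[symmetric] by (intro sum.cong refl) (simp add: B(2))
  finally have sq': "(\<Sum>i\<in>UNIV. \<Sum>j\<in>UNIV. B i j * (v $ j \<bullet> v $ j)) = (\<Sum>i\<in>UNIV. radius i * (v $ i \<bullet> v $ i))" .
  have "0 \<le> (\<Sum>i\<in>UNIV. \<Sum>j\<in>UNIV. B i j * ((v $ i + v $ j) \<bullet> (v $ i + v $ j)))"
    using B by (intro sum_nonneg mult_nonneg_nonneg) auto
  also have "\<dots> = (\<Sum>i\<in>UNIV. \<Sum>j\<in>UNIV. B i j * (v $ i \<bullet> v $ i) + B i j * (v $ j \<bullet> v $ j)
      + 2 * (B i j * (v $ j \<bullet> v $ i)))"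
    by (intro sum.cong refl) (simp add: inner_simps inner_commute algebra_simps)
  also have "\<dots> = 2 * ((\<Sum>i\<in>UNIV. radius i * (v $ i \<bullet> v $ i)) + (\<Sum>i\<in>UNIV. \<Sum>j\<in>UNIV. B i j * (v $ j \<bullet> v $ i)))"
    by (simp add: sum.distrib sq sq' flip: sum_distrib_left)
  finally have "0 \<le> (\<Sum>i\<in>UNIV. radius i * (v $ i \<bullet> v $ i)) + (\<Sum>i\<in>UNIV. \<Sum>j\<in>UNIV. B i j * (v $ j \<bullet> v $ i))"
    by simp
  also have "\<dots> \<le> (\<Sum>i\<in>UNIV. A $ i $ i * (v $ i \<bullet> v $ i)) + (\<Sum>i\<in>UNIV. \<Sum>j\<in>UNIV. B i j * (v $ j \<bullet> v $ i))"
    by (intro add_right_mono sum_mono mult_right_mono less_imp_le[OF radius_less] inner_ge_zero)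
  also have "\<dots> = (\<Sum>i\<in>UNIV. A $ i $ i * (v $ i \<bullet> v $ i) + (\<Sum>j\<in>UNIV. B i j * (v $ j \<bullet> v $ i)))"
    by (simp add: sum.distrib)
  also have "\<dots> = (\<Sum>i\<in>UNIV. mix A v $ i \<bullet> v $ i)"
  proof (intro sum.cong refl)
    fix i
    have "(\<Sum>j\<in>UNIV. B i j * (v $ j \<bullet> v $ i)) = (\<Sum>j\<in>UNIV - {i}. A $ i $ j * (v $ j \<bullet> v $ i))"
      unfolding sum.remove[of UNIV i, OF finite UNIV_I] by (simp add: B_def)
    then show "A $ i $ i * (v $ i \<bullet> v $ i) + (\<Sum>j\<in>UNIV. B i j * (v $ j \<bullet> v $ i)) = mix A v $ i \<bullet> v $ i"
      by (simp add: mix_component inner_sum_left sum.remove[of UNIV i "\<lambda>j. A $ i $ j * (v $ j \<bullet> v $ i)"])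
  qed
  finally show ?thesis .
qed

lemma fixed_point_mix:
  assumes "x \<in> fixed_points A"
  shows "mix A x $ i = norm (mix A x $ i) *\<^sub>R x $ i"
proof -
  have "sgn (mix A x $ i) = x $ i"
    using assms by (auto simp: fixed_points_def consensus_map_eq vec_eq_iff)
  then show ?thesis by (cases "mix A x $ i = 0") (simp_all add: sgn_div_norm flip: \<open>sgn (mix A x $ i) = x $ i\<close>)
qed


text \<open>
  Test directions are the tangential parts \<open>v\<^sub>i = b - (b \<bullet> x\<^sub>i) x\<^sub>i\<close> of a constant vector \<open>b\<close>. With
  \<open>c\<^sub>i\<^sub>j = x\<^sub>i \<bullet> x\<^sub>j\<close>, summing the energy gap over an orthonormal basis gives
  \<open>\<Sum>\<^sub>i\<^sub>j a\<^sub>i\<^sub>j (1 - c\<^sub>i\<^sub>j) (d - 2 - c\<^sub>i\<^sub>j)\<close>; this is where \<open>d \<ge> 3\<close> enters.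
\<close>

lemma unstable_direction:
  fixes x :: "real ^ 'd ^ 'n"
  assumes d: "CARD('d) \<ge> 3" and x: "x \<in> fixed_points A" and edge: "0 < A $ k $ l" "x $ k \<noteq> x $ l"
  obtains e where "vsgn_deriv x e = e"
    "(\<Sum>i\<in>UNIV. norm (mix A x $ i) * (e $ i \<bullet> e $ i)) < (\<Sum>i\<in>UNIV. mix A e $ i \<bullet> e $ i)"
proof -
  have sp: "x \<in> sphere_product" using x by (simp add: fixed_points_def)
  have unit: "x $ i \<bullet> x $ i = 1" for i using sphere_productD[OF sp] by (simp add: norm_eq_1)
  define lam where "lam i = norm (mix A x $ i)" for i
  define c where "c i j = x $ j \<bullet> x $ i" for i j
  \<comment> \<open>At a fixed point \<open>mix A x $ i\<close> is \<open>lam i\<close> times the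
    unit vector \<open>x $ i\<close>, so pairing with \<open>x $ i\<close> turns the norm into a sum
    linear in the \<open>c i j\<close>.\<close>
  have lam: "lam i = (\<Sum>j\<in>UNIV. A $ i $ j * c i j)" for i
  proof -
    have "mix A x $ i \<bullet> x $ i = (lam i *\<^sub>R x $ i) \<bullet> x $ i"
      using fixed_point_mix[OF x, of i] by (simp only: lam_def)
    then have "lam i = mix A x $ i \<bullet> x $ i" by (simp add: unit)
    also have "\<dots> = (\<Sum>j\<in>UNIV. A $ i $ j * c i j)"
      by (simp add: mix_component inner_sum_left c_def)
    finally show ?thesis .
  qed
  define v where "v b = vsgn_deriv x (\<chi> i. b)" for b
  have v: "v b $ i = b - (b \<bullet> x $ i) *\<^sub>R x $ i" for b i
    by (simp add: v_def vsgn_deriv_sphere_product[OF sp])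
  define F where "F b = (\<Sum>i\<in>UNIV. mix A (v b) $ i \<bullet> v b $ i) - (\<Sum>i\<in>UNIV. lam i * (v b $ i \<bullet> v b $ i))" for b
  have vv: "v b $ j \<bullet> v b $ i = b \<bullet> b - (x $ i \<bullet> b) * (x $ i \<bullet> b) - (x $ j \<bullet> b) * (x $ j \<bullet> b)
      + (x $ i \<bullet> b) * (x $ j \<bullet> b) * c i j" for b i j
    unfolding v by (simp add: c_def inner_diff_left inner_diff_right inner_commute algebra_simps)
  \<comment> \<open>This is the trace of the product of the projections orthogonal to
    \<open>x $ i\<close> and to \<open>x $ j\<close>.\<close>
  have trace: "(\<Sum>b\<in>Basis. v b $ j \<bullet> v b $ i) = real CARD('d) - 2 + (c i j)\<^sup>2" for i j
  proof -
    have "(\<Sum>b\<in>Basis. v b $ j \<bullet> v b $ i) = (\<Sum>b\<in>(Basis :: (real ^ 'd) set). b \<bullet> b) - x $ i \<bullet> x $ i - x $ j \<bullet> x $ j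
        + (x $ i \<bullet> x $ j) * c i j"
      unfolding vv sum.distrib sum_subtractf euclidean_inner[symmetric] sum_distrib_right[symmetric] ..
    also have "(\<Sum>b\<in>(Basis :: (real ^ 'd) set). b \<bullet> b) = real CARD('d)"
      by (simp add: inner_Basis)
    finally show ?thesis by (simp add: unit c_def power2_eq_square inner_commute)
  qed
  have cii: "c i i = 1" for i by (simp add: c_def unit)
  have "(\<Sum>b\<in>Basis. F b) = (\<Sum>i\<in>UNIV. \<Sum>j\<in>UNIV. A $ i $ j * (\<Sum>b\<in>Basis. v b $ j \<bullet> v b $ i))
      - (\<Sum>i\<in>UNIV. lam i * (\<Sum>b\<in>Basis. v b $ i \<bullet> v b $ i))"
    unfolding F_def mix_component inner_sum_left inner_scaleR_left sum_subtractf sum_distrib_left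
    by (simp only: sum.swap[of _ _ Basis])
  also have "\<dots> = (\<Sum>i\<in>UNIV. \<Sum>j\<in>UNIV. A $ i $ j * (real CARD('d) - 2 + (c i j)\<^sup>2)
      - A $ i $ j * c i j * (real CARD('d) - 1))"
    by (simp add: trace cii lam sum_subtractf sum_distrib_right)
  also have "\<dots> = (\<Sum>i\<in>UNIV. \<Sum>j\<in>UNIV. A $ i $ j * ((1 - c i j) * (real CARD('d) - 2 - c i j)))"
    by (intro sum.cong refl) (simp add: algebra_simps power2_eq_square)
  \<comment> \<open>For d at least 3, \<open>d - 2 - c i j\<close> is at least
    \<open>1 - c i j\<close>, which is nonnegative. The edge from \<open>k\<close> to
    \<open>l\<close> gives a strictly positive term.\<close>
  also have "\<dots> > 0"
  proof -
    have c1: "c i j \<le> 1" for i j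
      using Cauchy_Schwarz_ineq2[of "x $ i" "x $ j"] sphere_productD[OF sp] by (simp add: c_def inner_commute)
    have nonneg: "0 \<le> A $ i $ j * ((1 - c i j) * (real CARD('d) - 2 - c i j))" for i j
      using c1[of i j] d entries_nonneg by (intro mult_nonneg_nonneg) auto
    have "c k l \<noteq> 1"
    proof
      assume "c k l = 1"
      then have "(x $ k - x $ l) \<bullet> (x $ k - x $ l) = 0"
        by (simp add: c_def inner_diff_left inner_diff_right unit inner_commute)
      then show False using edge(2) by simp
    qed
    then have "c k l < 1" using c1 by (simp add: order_less_le)
    then have pos: "0 < A $ k $ l * ((1 - c k l) * (real CARD('d) - 2 - c k l))"
      using edge(1) d by (intro mult_pos_pos) auto
    have "0 < (\<Sum>j\<in>UNIV. A $ k $ j * ((1 - c k j) * (real CARD('d) - 2 - c k j)))"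
      using pos nonneg by (intro sum_pos2[of _ l]) auto
    then show ?thesis
      by (rule sum_pos2[OF finite UNIV_I]) (rule sum_nonneg, rule nonneg)
  qed
  finally have "\<not> (\<Sum>b\<in>Basis. F b) \<le> 0" by simp
  then obtain b where "0 < F b" by (meson not_le sum_nonpos)
  moreover have "vsgn_deriv x (v b) = v b"
    by (simp add: vec_eq_iff[of _ "v b"] vsgn_deriv_sphere_product[OF sp] v inner_diff_left unit)
  ultimately show thesis using that[of "v b"] by (simp add: F_def lam_def)
qed

text \<open>On tangent vectors this is the derivative of the consensus map. The inner projection
  extends it by 0 to normal directions, which makes it self-adjoint for \<open>energy x\<close> on
  the whole space when \<open>x\<close> is a fixed point.\<close>

definition linearization :: "real ^ 'd ^ 'n \<Rightarrow> real ^ 'd ^ 'n \<Rightarrow> real ^ 'd ^ 'n" where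
  "linearization x v = vsgn_deriv (mix A x) (mix A (vsgn_deriv x v))"

definition energy :: "real ^ 'd ^ 'n \<Rightarrow> real ^ 'd ^ 'n \<Rightarrow> real ^ 'd ^ 'n \<Rightarrow> real" where
  "energy x u v = (\<Sum>i\<in>UNIV. norm (mix A x $ i) * (u $ i \<bullet> v $ i))"

lemma linear_linearization: "linear (linearization x)"
  unfolding linearization_def
  using linear_compose[OF linear_compose[OF linear_vsgn_deriv linear_mix] linear_vsgn_deriv]
  by (simp add: comp_def)

text \<open>The weights of \<open>energy\<close> cancel the division by the norms in
  \<open>vsgn_deriv (mix A x)\<close>. What remains is the compression of \<open>mix A\<close> to
  the tangent space, so symmetry and positivity are inherited from \<open>A\<close>.\<close>

lemma energy_linearization:
  assumes x: "x \<in> fixed_points A"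
  shows "energy x (linearization x u) v = (\<Sum>i\<in>UNIV. mix A (vsgn_deriv x u) $ i \<bullet> vsgn_deriv x v $ i)"
  unfolding energy_def
proof (intro sum.cong refl)
  fix i
  have sp: "x \<in> sphere_product" using x by (simp add: fixed_points_def)
  have "sgn (mix A x $ i) = x $ i"
    using x by (auto simp: fixed_points_def consensus_map_eq vec_eq_iff)
  then have "linearization x u $ i = vsgn_deriv x (mix A (vsgn_deriv x u)) $ i /\<^sub>R norm (mix A x $ i)"
    unfolding vsgn_deriv_sphere_product[OF sp] by (simp add: linearization_def vsgn_deriv_def[of "mix A x"] sgn_deriv_def)
  then have "norm (mix A x $ i) * (linearization x u $ i \<bullet> v $ i)
      = vsgn_deriv x (mix A (vsgn_deriv x u)) $ i \<bullet> v $ i"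
    using mix_nonzero[OF sp, of i] by simp
  then show "norm (mix A x $ i) * (linearization x u $ i \<bullet> v $ i)
      = mix A (vsgn_deriv x u) $ i \<bullet> vsgn_deriv x v $ i"
    by (simp add: vsgn_deriv_selfadjoint[OF sp])
qed

lemma self_adjoint_form_energy:
  fixes x :: "real ^ 'd ^ 'n"
  assumes x: "x \<in> fixed_points A"
  shows "self_adjoint_form (energy x) (linearization x) (Min (range (\<lambda>i. norm (mix A x $ i))))"
    (is "self_adjoint_form _ _ ?g")
proof (rule self_adjoint_form.intro)
  have sp: "x \<in> sphere_product" using x by (simp add: fixed_points_def)
  fix u v :: "real ^ 'd ^ 'n"
  have "bilinear (energy x)"
    unfolding bilinear_def
    by (auto intro!: linearI simp: energy_def inner_add_left inner_add_right distrib_left sum.distrib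
        sum_distrib_left mult.left_commute)
  then show "bounded_bilinear (energy x)" by (simp add: bilinear_conv_bounded_bilinear)
  show "energy x u v = energy x v u" by (simp add: energy_def inner_commute)
  show "0 < ?g" using mix_nonzero[OF sp] by simp
  have "(norm v)\<^sup>2 = (\<Sum>i\<in>UNIV. v $ i \<bullet> v $ i)"
    by (simp add: power2_norm_eq_inner inner_vec_def)
  then have "?g * (norm v)\<^sup>2 = (\<Sum>i\<in>UNIV. ?g * (v $ i \<bullet> v $ i))"
    by (simp add: sum_distrib_left)
  also have "\<dots> \<le> energy x v v"
    unfolding energy_def by (intro sum_mono mult_right_mono) auto
  finally show "?g * (norm v)\<^sup>2 \<le> energy x v v" .
  show "linear (linearization x)" by (rule linear_linearization)
  have "energy x (linearization x u) v = energy x (linearization x v) u"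
    unfolding energy_linearization[OF x] mix_selfadjoint[of "vsgn_deriv x u"] by (simp add: inner_commute)
  then show "energy x (linearization x u) v = energy x u (linearization x v)"
    by (simp add: energy_def inner_commute)
  show "0 \<le> energy x (linearization x v) v"
    unfolding energy_linearization[OF x] by (rule mix_nonneg)
qed

text \<open>Half of \<epsilon> pays for the strict differentiability error of \<open>vsgn\<close> at
  \<open>mix A x\<close>, the other half for the normal part of the chord \<open>y - y'\<close>,
  which \<open>linearization x\<close> discards.\<close>

lemma linearization_approx:
  fixes x :: "real ^ 'd ^ 'n"
  assumes x: "x \<in> fixed_points A" and "0 < \<epsilon>"
  obtains r where "0 < r" "\<And>y y'. \<lbrakk>y \<in> sphere_product; y' \<in> sphere_product; norm (y - x) \<le> r; norm (y' - x) \<le> r\<rbrakk>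
    \<Longrightarrow> norm (consensus_map A y - consensus_map A y' - linearization x (y - y')) \<le> \<epsilon> * norm (y - y')"
proof -
  have sp: "x \<in> sphere_product" using x by (simp add: fixed_points_def)
  let ?D = "vsgn_deriv (mix A x)"
  obtain M where M: "0 < M" "\<And>v :: real ^ 'd ^ 'n. norm (mix A v) \<le> M * norm v"
    using linear_bounded_pos[OF linear_mix] by metis
  obtain N where N: "0 < N" "\<And>v. norm (?D (mix A v)) \<le> N * norm v"
    using linear_bounded_pos[OF linear_compose[OF linear_mix linear_vsgn_deriv[of "mix A x"]]]
    by (metis comp_apply)
  have "0 < \<epsilon> / (2 * M)" using assms(2) M(1) by simp
  from vsgn_strictly_differentiable[OF mix_nonzero[OF sp] this]
  obtain \<delta> where \<delta>: "0 < \<delta>" "\<And>p q. \<lbrakk>norm (p - mix A x) < \<delta>; norm (q - mix A x) < \<delta>\<rbrakk>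
    \<Longrightarrow> norm (vsgn p - vsgn q - ?D (p - q)) \<le> \<epsilon> / (2 * M) * norm (p - q)" by metis
  define r where "r = min (\<delta> / (2 * M)) (\<epsilon> / (2 * N))"
  show thesis
  proof (rule that)
    show "0 < r" using \<delta>(1) assms(2) M(1) N(1) by (simp add: r_def)
    fix y y' assume y: "y \<in> sphere_product" "y' \<in> sphere_product" and r: "norm (y - x) \<le> r" "norm (y' - x) \<le> r"
    define v where "v = y - y'"
    have near: "norm (mix A w - mix A x) < \<delta>" if "norm (w - x) \<le> r" for w
    proof -
      have "norm (mix A w - mix A x) \<le> M * norm (w - x)"
        using M(2)[of "w - x"] by (simp add: linear_diff[OF linear_mix])
      also have "\<dots> \<le> M * (\<delta> / (2 * M))"
        using that M(1) by (intro mult_left_mono) (auto simp: r_def)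
      also have "\<dots> < \<delta>" using M(1) \<delta>(1) by simp
      finally show ?thesis .
    qed
    have "norm (consensus_map A y - consensus_map A y' - ?D (mix A v)) \<le> \<epsilon> / (2 * M) * norm (mix A v)"
      using \<delta>(2)[OF near[OF r(1)] near[OF r(2)]]
      by (simp add: consensus_map_eq v_def linear_diff[OF linear_mix])
    also have "\<dots> \<le> \<epsilon> / (2 * M) * (M * norm v)"
      using M assms(2) by (intro mult_left_mono) auto
    also have "\<dots> = \<epsilon> / 2 * norm v" using M(1) by simp
    finally have 1: "norm (consensus_map A y - consensus_map A y' - ?D (mix A v)) \<le> \<epsilon> / 2 * norm v" .
    have "?D (mix A v) - linearization x v = ?D (mix A (v - vsgn_deriv x v))"
      by (simp add: linearization_def linear_diff[OF linear_mix] linear_diff[OF linear_vsgn_deriv])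
    then have "norm (?D (mix A v) - linearization x v) \<le> N * norm (v - vsgn_deriv x v)"
      using N(2) by simp
    also have "\<dots> \<le> N * (r * norm v)"
      using norm_chord_normal_part_le[OF sp y r] N(1) by (simp add: v_def)
    also have "\<dots> \<le> N * (\<epsilon> / (2 * N) * norm v)"
      using N(1) by (intro mult_left_mono mult_right_mono) (auto simp: r_def)
    also have "\<dots> = \<epsilon> / 2 * norm v" using N(1) by simp
    finally have 2: "norm (?D (mix A v) - linearization x v) \<le> \<epsilon> / 2 * norm v" .
    have "norm (consensus_map A y - consensus_map A y' - linearization x v) \<le> \<epsilon> / 2 * norm v + \<epsilon> / 2 * norm v"
      by (rule norm_diff_triangle_le[OF 1 2])
    then show "norm (consensus_map A y - consensus_map A y' - linearization x (y - y')) \<le> \<epsilon> * norm (y - y')"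
      by (simp add: v_def)
  qed
qed

section \<open>Trapped orbits form a null set\<close>

definition trapped :: "(real ^ 'd ^ 'n) \<Rightarrow> real \<Rightarrow> (real ^ 'd ^ 'n) set" where
  "trapped x r = {y \<in> sphere_product. \<forall>k. (consensus_map A ^^ k) y \<in> cball x r}"

text \<open>Closed balls make the trapped set an intersection of closed preimages. Closedness serves
  both \<open>starlike_negligible\<close> and Borel measurability.\<close>

lemma closed_trapped: "closed (trapped x r)"
proof -
  have "trapped x r = (\<Inter>k. sphere_product \<inter> (consensus_map A ^^ k) -` cball x r)"
    by (auto simp: trapped_def)
  also have "closed \<dots>"
    using compact_imp_closed[OF compact_sphere_product]
    by (intro closed_INT ballI continuous_closed_preimage continuous_on_iterate) auto
  finally show ?thesis .
qed

text \<open>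
  Near \<open>x\<close>, a ray issuing from \<open>x - e\<close> points in a direction close to \<open>e\<close>, so by
  \<open>unstable_separation\<close> it meets the cone over the trapped set at most once.
\<close>

lemma negligible_trapped:
  fixes x :: "real ^ 'd ^ 'n"
  assumes x: "x \<in> fixed_points A" and e: "vsgn_deriv x e = e"
    "energy x e e < energy x (linearization x e) e"
  obtains r where "0 < r" "negligible (radial_cone (trapped x r))"
proof -
  have sp: "x \<in> sphere_product" using x by (simp add: fixed_points_def)
  interpret self_adjoint_form "energy x" "linearization x" "Min (range (\<lambda>i. norm (mix A x $ i)))"
    by (rule self_adjoint_form_energy[OF x])
  obtain \<epsilon> \<eta> where \<epsilon>: "0 < \<epsilon>" and \<eta>: "0 < \<eta>"
    and sep: "\<And>v c. \<lbrakk>\<And>k. norm (v (Suc k) - linearization x (v k)) \<le> \<epsilon> * norm (v k); bounded (range v)\<rbrakk>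
       \<Longrightarrow> \<eta> * \<bar>c\<bar> \<le> norm (v 0 - c *\<^sub>R e)"
    using unstable_separation[OF e(2)] by metis
  obtain r0 where r0: "0 < r0" "\<And>y y'. \<lbrakk>y \<in> sphere_product; y' \<in> sphere_product; norm (y - x) \<le> r0; norm (y' - x) \<le> r0\<rbrakk>
    \<Longrightarrow> norm (consensus_map A y - consensus_map A y' - linearization x (y - y')) \<le> \<epsilon> * norm (y - y')"
    using linearization_approx[OF x \<epsilon>] by metis
  \<comment> \<open>Ray directions satisfy \<open>norm w \<le> norm e + 1\<close>, so this choice
    makes the error in \<open>vsgn\<close> at most a quarter of \<eta> per unit of
    \<open>\<bar>c - 1\<bar>\<close>.\<close>
  define \<kappa> where "\<kappa> = \<eta> / (4 * (norm e + 1))"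
  have ne: "0 < norm e + 1" by (simp add: add_nonneg_pos)
  have \<kappa>: "0 < \<kappa>" "\<kappa> * (norm e + 1) = \<eta> / 4" using \<eta> ne by (simp_all add: \<kappa>_def field_simps)
  have "x $ i \<noteq> 0" for i using sphere_productD[OF sp, of i] by auto
  from vsgn_strictly_differentiable[OF this \<kappa>(1)]
  obtain \<delta> where \<delta>: "0 < \<delta>" "\<And>p q. \<lbrakk>norm (p - x) < \<delta>; norm (q - x) < \<delta>\<rbrakk>
    \<Longrightarrow> norm (vsgn p - vsgn q - vsgn_deriv x (p - q)) \<le> \<kappa> * norm (p - q)" by metis
  define \<rho> where "\<rho> = min (min 1 (\<eta> / 4)) (\<delta> / 2)"
  have \<rho>: "0 < \<rho>" "\<rho> \<le> 1" "\<rho> \<le> \<eta> / 4" "\<rho> < \<delta>"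
    using \<eta> \<delta>(1) by (auto simp: \<rho>_def)
  \<comment> \<open>Each component of \<open>z\<close> is within \<open>s\<close> of its direction,
    and that direction is within \<open>s\<close> of \<open>x\<close>; summing over components gives
    \<rho>.\<close>
  define s where "s = \<rho> / (2 * real CARD('n))"
  have s: "0 < s" "real CARD('n) * (s + s) = \<rho>" using \<rho>(1) by (simp_all add: s_def field_simps)
  define r where "r = min r0 s"
  have r: "0 < r" "r \<le> r0" "r \<le> s" using r0(1) s(1) by (simp_all add: r_def)
  define t where "t = min (1 / 2) s"
  have t: "0 < t" "t < 1" "t \<le> s" using s(1) by (auto simp: t_def)
  define shell where "shell = {z :: real ^ 'd ^ 'n. \<forall>i. norm (z $ i) \<in> {1 - t..1 + t}}"
  \<comment> \<open>On the shell the components stay away from 0, so \<open>vsgn\<close> is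
    continuous there and \<open>Z\<close> is closed.\<close>
  define Z where "Z = radial_cone (trapped x r) \<inter> shell"
  have near: "norm (z - x) \<le> \<rho>" if z: "z \<in> Z" for z
  proof -
    have "norm ((z - x) $ i) \<le> s + s" for i
    proof -
      have nz: "\<bar>norm (z $ i) - 1\<bar> \<le> t" "z $ i \<noteq> 0"
        using z by (simp_all add: Z_def shell_def radial_cone_def abs_le_iff algebra_simps)
      have "\<forall>k. (consensus_map A ^^ k) (vsgn z) \<in> cball x r"
        using z by (simp add: Z_def radial_cone_def trapped_def)
      from this[rule_format, of 0] have "vsgn z \<in> cball x r" by simp
      then have "norm (vsgn z - x) \<le> r" by (simp add: dist_norm norm_minus_commute)
      then have 1: "norm (sgn (z $ i) - x $ i) \<le> s"
        using Finite_Cartesian_Product.norm_nth_le[of "vsgn z - x" i] r(3) by simp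
      have "z $ i - sgn (z $ i) = (norm (z $ i) - 1) *\<^sub>R sgn (z $ i)"
        using nz(2) by (simp add: sgn_div_norm algebra_simps)
      then have 2: "norm (z $ i - sgn (z $ i)) \<le> s"
        using nz t(3) by (simp add: norm_sgn)
      show ?thesis using norm_triangle_le[OF add_mono[OF 2 1]] by simp
    qed
    then have "norm (z - x) \<le> real CARD('n) * (s + s)" by (rule norm_vec_le_card)
    then show ?thesis by (simp only: s(2))
  qed
  have "closed Z"
  proof -
    have nz: "z $ i \<noteq> 0" if "z \<in> shell" for z i
    proof
      assume "z $ i = 0"
      moreover have "1 - t \<le> norm (z $ i)" using that by (simp add: shell_def)
      ultimately show False using t(2) by simp
    qed
    then have Z: "Z = shell \<inter> vsgn -` trapped x r"
      by (auto simp: Z_def radial_cone_def)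
    have shell: "shell = (\<Inter>i. {z. 1 - t \<le> norm (z $ i)} \<inter> {z. norm (z $ i) \<le> 1 + t})"
      by (auto simp: shell_def)
    have "closed shell"
      unfolding shell by (intro closed_INT ballI closed_Int closed_Collect_le continuous_intros)
    have "continuous_on shell vsgn"
      unfolding vsgn_def sgn_div_norm by (intro continuous_intros) (simp_all add: nz)
    then show ?thesis
      unfolding Z using \<open>closed shell\<close> closed_trapped by (rule continuous_closed_preimage)
  qed
  then have "negligible Z"
  proof (rule starlike_negligible[of _ "x - e"])
    fix c w assume c: "x - e + c *\<^sub>R w \<in> Z" "0 \<le> c" "x - e + w \<in> Z"
    define z z' where "z = x - e + w" and "z' = x - e + c *\<^sub>R w"
    have zz: "z \<in> Z" "z' \<in> Z" using c by (simp_all add: z_def z'_def)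
    have w: "w = e + (z - x)" "z' - z = (c - 1) *\<^sub>R w" by (simp_all add: z_def z'_def algebra_simps)
    define y y' where "y k = (consensus_map A ^^ k) (vsgn z)" and "y' k = (consensus_map A ^^ k) (vsgn z')" for k
    define v where "v k = y' k - y k" for k
    have orbit: "y k \<in> sphere_product" "norm (y k - x) \<le> r" "y' k \<in> sphere_product" "norm (y' k - x) \<le> r" for k
      using zz by (auto simp: Z_def radial_cone_def trapped_def y_def y'_def dist_norm norm_minus_commute
          intro: iterate_sphere_product)
    have step: "norm (v (Suc k) - linearization x (v k)) \<le> \<epsilon> * norm (v k)" for k
      using r0(2)[OF orbit(3)[of k] orbit(1)[of k]] orbit(2,4)[of k] r(2)
      by (simp add: v_def y_def y'_def)
    have "norm (v k) \<le> r + r" for k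
      using norm_triangle_le_diff[OF add_mono[OF orbit(4)[of k] orbit(2)[of k]]] by (simp add: v_def)
    then have "bounded (range v)" by (auto intro: boundedI)
    with step have "\<eta> * \<bar>c - 1\<bar> \<le> norm (v 0 - (c - 1) *\<^sub>R e)" by (rule sep)
    \<comment> \<open>The derivative maps \<open>(c - 1) *\<^sub>R w\<close> to
      \<open>(c - 1) *\<^sub>R e\<close> plus the projection of
      \<open>(c - 1) *\<^sub>R (z - x)\<close>, because \<open>e\<close> is tangent.\<close>
    also have "v 0 - (c - 1) *\<^sub>R e = (vsgn z' - vsgn z - vsgn_deriv x (z' - z)) + (c - 1) *\<^sub>R vsgn_deriv x (z - x)"
      by (simp add: v_def y_def y'_def w(2) linear_scale[OF linear_vsgn_deriv])
        (simp add: w(1) linear_add[OF linear_vsgn_deriv] e(1) scaleR_add_right)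
    also have "norm \<dots> \<le> \<kappa> * norm (z' - z) + \<bar>c - 1\<bar> * norm (z - x)"
      using near[OF zz(1)] near[OF zz(2)] \<rho>(4) norm_vsgn_deriv_le[OF sp, of "z - x"]
      by (intro norm_triangle_le add_mono \<delta>(2)) (auto intro: mult_left_mono)
    also have "\<dots> \<le> \<bar>c - 1\<bar> * (\<eta> / 4) + \<bar>c - 1\<bar> * (\<eta> / 4)"
    proof (intro add_mono mult_left_mono)
      have "norm w \<le> norm e + 1"
        unfolding w(1) using near[OF zz(1)] \<rho>(2) by (intro norm_triangle_le) auto
      then have "\<kappa> * norm w \<le> \<eta> / 4"
        unfolding \<kappa>(2)[symmetric] using \<kappa>(1) by (intro mult_left_mono) auto
      then have "\<bar>c - 1\<bar> * (\<kappa> * norm w) \<le> \<bar>c - 1\<bar> * (\<eta> / 4)" by (intro mult_left_mono) auto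
      then show "\<kappa> * norm (z' - z) \<le> \<bar>c - 1\<bar> * (\<eta> / 4)"
        by (simp add: w(2) mult.left_commute)
      show "norm (z - x) \<le> \<eta> / 4" using near[OF zz(1)] \<rho>(3) by simp
    qed simp
    \<comment> \<open>The upper bound is only half of the lower bound from
      \<open>sep\<close>.\<close>
    finally have "\<eta> * \<bar>c - 1\<bar> \<le> 0" by (simp add: algebra_simps)
    then show "c = 1" using \<eta> by (simp add: mult_le_0_iff)
  qed
  then have "negligible (radial_cone (trapped x r))"
    unfolding Z_def shell_def by (rule negligible_radial_cone_shell[OF t(1)])
  then show thesis using that r(1) by blast
qed

end

section \<open>Covering by countably many preimages of trapped sets\<close>

lemma strongly_connected_nonconstant_edge:
  assumes "strongly_connected E" "x i \<noteq> x j"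
  obtains k l where "(k, l) \<in> E" "x k \<noteq> x l"
proof (rule ccontr)
  assume "\<not> thesis"
  then have "\<And>k l. (k, l) \<in> E \<Longrightarrow> x k = x l" using that by blast
  then have edge: "\<And>k l. (k, l) \<in> E \<Longrightarrow> x k = x l" .
  have "x i = x j" if "(i, j) \<in> E\<^sup>*"
    using that
  proof (induction rule: rtrancl_induct)
    case (step k l)
    then show ?case using edge[of k l] by simp
  qed simp
  then show False using assms by (simp add: strongly_connected_def)
qed

theorem theorem1:
  fixes E :: "('n::finite \<times> 'n) set"
    and A :: "real ^ 'n ^ 'n"
  assumes "CARD('d::finite) \<ge> 3"
    and "sym E"
    and "strongly_connected E"
    and "weight_matrix E A"
    and "transpose A = A"
    and "\<And>i. A $ i $ i > sqrt 2 * (\<Sum>j\<in>UNIV - {i}. A $ i $ j)"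
  shows "{x \<in> (sphere_product :: (real ^ 'd ^ 'n) set).
            \<exists>x_inf \<in> fixed_points A - consensus_set.
              (\<lambda>k. (consensus_map A ^^ k) x) \<longlonglongrightarrow> x_inf}
         \<in> null_sets (completion sphere_product_measure)"
proof -
  interpret dominant_matrix A
  proof
    show "0 \<le> A $ i $ j" for i j using assms(4) by (simp add: weight_matrix_def)
    show "A $ i $ j = A $ j $ i" for i j
      using arg_cong[OF assms(5), of "\<lambda>B. B $ j $ i"] by (simp add: transpose_def)
  qed (rule assms(6))
  let ?X = "fixed_points A - consensus_set :: (real ^ 'd ^ 'n) set"
  have "\<exists>r. 0 < r \<and> negligible (radial_cone (trapped x r))" if x: "x \<in> ?X" for x
  proof -
    obtain i j where "x $ i \<noteq> x $ j"
      using x unfolding fixed_points_def consensus_set_def by blast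
    then obtain k l where kl: "(k, l) \<in> E" "x $ k \<noteq> x $ l"
      by (rule strongly_connected_nonconstant_edge[OF assms(3), where x = "($) x"])
    then have "k \<noteq> l" by auto
    then have "0 < A $ k $ l" using assms(4) kl(1) by (simp add: weight_matrix_def)
    then obtain e where e: "vsgn_deriv x e = e"
      "(\<Sum>i\<in>UNIV. norm (mix A x $ i) * (e $ i \<bullet> e $ i)) < (\<Sum>i\<in>UNIV. mix A e $ i \<bullet> e $ i)"
      using unstable_direction[OF assms(1)] x kl(2) by blast
    have "energy x e e < energy x (linearization x e) e"
      using e x unfolding energy_def[of x e e] by (simp add: energy_linearization)
    with x e(1) show ?thesis by (meson DiffD1 negligible_trapped)
  qed
  then obtain r where r: "\<And>x. x \<in> ?X \<Longrightarrow> 0 < r x \<and> negligible (radial_cone (trapped x (r x)))"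
    by metis
  \<comment> \<open>The limit is not known in advance and the fixed points may form a continuum, so
    a countable subfamily of the balls is extracted.\<close>
  obtain F where F: "F \<subseteq> (\<lambda>x. ball x (r x)) ` ?X" "countable F" "\<Union>F = (\<Union>x\<in>?X. ball x (r x))"
    by (rule Lindelof[of "(\<lambda>x. ball x (r x)) ` ?X"]) auto
  then obtain Y where Y: "countable Y" "Y \<subseteq> ?X" "F = (\<lambda>x. ball x (r x)) ` Y"
    by (meson countable_subset_image)
  \<comment> \<open>\<open>T k y\<close> collects the starting points whose orbit stays in the
    closed ball about \<open>y\<close> from time \<open>k\<close> on.\<close>
  define T where "T k y = {x \<in> sphere_product. (consensus_map A ^^ k) x \<in> trapped y (r y)}" for k y
  have "T k y \<in> null_sets sphere_product_measure" if "y \<in> Y" for k y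
  proof (rule null_sets_sphere_product_measure)
    have "T k y = sphere_product \<inter> (consensus_map A ^^ k) -` trapped y (r y)"
      by (auto simp: T_def)
    also have "closed \<dots>"
      using compact_imp_closed[OF compact_sphere_product]
      by (intro continuous_closed_preimage continuous_on_iterate closed_trapped)
    finally show "T k y \<in> sets borel" by simp
    show "T k y \<subseteq> sphere_product" by (auto simp: T_def)
    show "negligible (radial_cone (T k y))"
      unfolding T_def using r Y(2) that by (intro negligible_iterated_preimage) blast
  qed
  then have "(\<Union>(k, y)\<in>UNIV \<times> Y. T k y) \<in> null_sets sphere_product_measure"
    using Y(1) by (intro null_sets_UN') auto
  moreover have "{x \<in> sphere_product. \<exists>x_inf \<in> ?X. (\<lambda>k. (consensus_map A ^^ k) x) \<longlonglongrightarrow> x_inf}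
      \<subseteq> (\<Union>(k, y)\<in>UNIV \<times> Y. T k y)"
  proof clarify
    fix x p :: "real ^ 'd ^ 'n"
    assume x: "x \<in> sphere_product" and p: "p \<in> fixed_points A" "p \<notin> consensus_set"
      and lim: "(\<lambda>k. (consensus_map A ^^ k) x) \<longlonglongrightarrow> p"
    have "p \<in> ?X" using p by blast
    moreover from this have "p \<in> ball p (r p)" using r by simp
    ultimately have "p \<in> \<Union>F" unfolding F(3) by blast
    then obtain y where y: "y \<in> Y" "p \<in> ball y (r y)" unfolding Y(3) by blast
    have "eventually (\<lambda>k. (consensus_map A ^^ k) x \<in> ball y (r y)) sequentially"
      using lim open_ball y(2) by (rule topological_tendstoD)
    then obtain k where k: "\<And>m. k \<le> m \<Longrightarrow> (consensus_map A ^^ m) x \<in> ball y (r y)"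
      by (auto simp: eventually_sequentially)
    have "(consensus_map A ^^ m) ((consensus_map A ^^ k) x) \<in> cball y (r y)" for m
      using subsetD[OF ball_subset_cball k[of "m + k"]] by (simp only: funpow_add comp_apply le_add2)
    then have "x \<in> T k y" using x iterate_sphere_product[OF x] by (simp add: T_def trapped_def)
    then show "x \<in> (\<Union>(k, y)\<in>UNIV \<times> Y. T k y)" using y(1) by blast
  qed
  \<comment> \<open>The set in question is covered by a Borel null set; the completion makes such a
    subset measurable and null.\<close>
  ultimately show ?thesis
    by (metis (no_types, lifting) null_sets_completionI null_sets_completion_subset)
qed

end
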